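(* Given a learned-symmetric market $\mathcal M$ and a realization $S$ of the set of learned businesses, there is almost surely a unique symmetric market equilibrium with learned set $S$. In this equilibrium, if we take $n=|S|$ and write $(\pi,Q)$ for the common type of the businesses in $S$, each business (in $S$) obtains expected revenue $(1-\pi)^{n-1}R^*$ and randomizes prices on the range $[\underline p,p^*]$ according to the cumulative distribution function $$G(p)=\frac1\pi\left[1-(1-\pi)\left(\frac{p^*D(p^* )}{p\,D(p)}\right)^{\frac1{n-1}}\right],$$ where $\underline p$ is the maximum value such that $G(\underline p)=0$.
   Context: A market $\mathcal M$ with endogenous prices consists of: $m$ businesses $j\in[m]$ with parameters $\pi_j\in(0,1)$ (fit probability) and $Q_j\in[0,1]$ (quality); a value distribution $\mathcal D^V$ that is regular (with CDF $\Psi$ and density $\psi$, $v-(1-\Psi(v))/\psi(v)$ is non-decreasing), admits a density, and has bounded support contained in $[0,\overline V]$; a common prior, i.e. known prior distributions (possibly different for different businesses) from which the $\pi_j$ and $Q_j$ are independently drawn; a search cost $c\ge 0$; and for each business a demand-responsive pricing rule (defined below). The parameters of a market are a fixed potential realization of the prior; consumers know the prior but not the parameters. Dynamics: in round $i=1,2,\dots$ each business sets a publicly observed price $P_{ij}\ge0$ as a (possibly randomized) function of the past history $H^{\mathcal M}_{i-1}$, and consumer $i$ arrives with value $V_i\sim\mathcal D^V$ (drawn independently). For each $j$, fit $F_{ij}\sim\mathrm{Bernoulli}(\pi_j)$ and quality realization $q_{ij}\sim\mathrm{Bernoulli}(Q_j)$, all independent. She sequentially inspects businesses at cost $c$ each,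 observing $F_{ij}$, and transacts with at most one inspected business; transacting with $j$ gives expected transaction utility $V_iQ_jF_{ij}-P_{ij}$ given $F_{ij}$. The history records prices, inspected businesses with $F_{ij}$, and the transacted business with $q_{ij}$. Let $\hat\pi_{ij},\hat Q_{ij}$ be the posterior means of $\pi_j,Q_j$ given $H^{\mathcal M}_{i-1}$ (no inference from prices) and $\sigma_j(P,\hat\pi,\hat Q,V)=V\hat Q-P-c/\hat\pi$. Optimal search: inspect businesses with $\sigma_j(P_{ij},\hat\pi_{ij},\hat Q_{ij},V_i)>0$ in decreasing order of index, transact with the first that fits ($F_{ij}=1$), then leave. Demand-responsive: $P_{ij}$ is such that $\sigma_j(P_{ij},\hat\pi_{ij},\hat Q_{ij},\overline V)>0$ whenever some price $\ge0$ achieves this. Business $j$ is learned if the posteriors of $(\pi_j,Q_j)$ converge (in probability, as $i\to\infty$) to the true values; it is lost if $\sigma_j(0,\hat\pi_{ij},\hat Q_{ij},\overline V)\le0$ for some consumer $i$ and every consumer afterwards. $S^{\mathrm{lnd}}(\mathcal M)$ is the random set of learned businesses. $\mathcal M$ is learned-symmetric if, almost surely over the realization $S$ of $S^{\mathrm{lnd}}(\mathcal M)$, all businesses in $S$ have the same type: $\pi_j=\pi_{j'}$ and $Q_j=Q_{j'}$ for all $j,j'\in S$. A (steady-state) market equilibrium specifies limit beliefs $\mathcal P^{\lim}=(\mathcal P^{\lim}_j)_{j\in[m]}$ and price distributions $(\Gamma_j)_{j\in[m]}$ such that (1) under $\mathcal P^{\lim}$ each business is either learned (beliefs are a point mass at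 $(\pi_j,Q_j)$) or lost (index at price $0$ and value $\overline V$ is $\le0$); (2) for each $j$, fixing the other businesses' price distributions, each price in the support of $\Gamma_j$ maximizes $j$'s expected revenue from a consumer with beliefs $\mathcal P^{\lim}$ and value drawn from $\mathcal D^V$ who searches optimally. Lost businesses are never inspected and their precise beliefs are not payoff-relevant, so an equilibrium is described by its learned set and the price distributions of the learned businesses; it is symmetric if all learned businesses use the same price distribution. Effective value: $W$ equals $0$ with probability $1-\pi$ and equals $VQ-c/\pi$ with $V\sim\mathcal D^V$ otherwise. $D(p)=\Pr[W>p]$ is the probability of sale at price $p$ by a monopolist seller facing a consumer of value $W$, $R^*=\sup_p p\,D(p)$ is the optimal monopolist revenue, and $p^*$ is a price attaining $R^*$.
   Formalization: Assumes R*>0 for the learned type and, if n=1, that the monopoly price p* is unique (otherwise equilibrium is not unique); for n=1 the price law is read as a point mass at p*; the lower price is the largest zero of G within [0,p*], since G has further zeros above p*. *)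

theory Defs
  imports "HOL-Probability.Probability"
begin

text \<open>
  Businesses are the numbers \<open>j < nbiz M\<close>, and rounds (consumers) are numbered from \<open>0\<close>.
  One round of history consists of the posted prices, the observed fit of every inspected
  business (\<open>None\<close> if not inspected), and the business transacted with, if any, together with
  its quality realization.
\<close>

type_synonym round_record = "(nat \<Rightarrow> real) \<times> (nat \<Rightarrow> bool option) \<times> (nat \<times> bool) option"
type_synonym history = "nat \<Rightarrow> round_record"

text \<open>
  \<open>price M j i H u\<close> is the price that \<open>j\<close> posts in round \<open>i\<close> after the history \<open>H\<close> of the rounds
  \<open>{..<i}\<close>. The argument \<open>u\<close> is a private uniform seed, which makes randomized pricing possible.
  \<open>tie\<close> is the law of a ranking used by consumers to break ties between equal indices (a smaller
  number means earlier); it is arbitrary, so fixed as well as uniformly random tie-breaking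
  are covered.
\<close>

record market =
  nbiz :: nat
  fitp :: "nat \<Rightarrow> real"
  qual :: "nat \<Rightarrow> real"
  vbar :: real
  valdist :: "real measure"
  prior_fit :: "nat \<Rightarrow> real measure"
  prior_qual :: "nat \<Rightarrow> real measure"
  cost :: real
  price :: "nat \<Rightarrow> nat \<Rightarrow> history \<Rightarrow> real \<Rightarrow> real"
  tie :: "(nat \<Rightarrow> nat) pmf"

definition msupport :: "real measure \<Rightarrow> real set" where
  "msupport N = {x. \<forall>U. open U \<longrightarrow> x \<in> U \<longrightarrow> 0 < measure N U}"

text \<open>
  The virtual value is extended-real: where the density vanishes below the top of the support
  it is \<open>- \<infinity>\<close> (as \<open>a / 0 = \<infinity>\<close> for \<open>a > 0\<close> in \<open>ereal\<close>), so that monotonicity is violated there.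
\<close>

definition regular_dist :: "real measure \<Rightarrow> bool" where
  "regular_dist D \<longleftrightarrow>
     (\<exists>\<psi> \<in> borel_measurable borel. (\<forall>v. 0 \<le> \<psi> v) \<and> D = density lborel (\<lambda>v. ennreal (\<psi> v)) \<and>
        mono_on {v. 0 < cdf D v \<and> cdf D v < 1}
          (\<lambda>v. ereal v - ereal (1 - cdf D v) / ereal (\<psi> v)))"


subsection \<open>Consumer search\<close>

definition search_index :: "real \<Rightarrow> real \<Rightarrow> real \<Rightarrow> real \<Rightarrow> real \<Rightarrow> real" where
  "search_index c p \<pi>h Qh v = v * Qh - p - c / \<pi>h"

definition before :: "(nat \<Rightarrow> real) \<Rightarrow> (nat \<Rightarrow> nat) \<Rightarrow> nat \<Rightarrow> nat \<Rightarrow> bool" where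
  "before \<sigma> \<tau> k j \<longleftrightarrow> \<sigma> j < \<sigma> k \<or> (\<sigma> j = \<sigma> k \<and> \<tau> k < \<tau> j)"

text \<open>Businesses of positive index are inspected in decreasing order until one of them fits.\<close>

definition inspected :: "nat \<Rightarrow> (nat \<Rightarrow> real) \<Rightarrow> (nat \<Rightarrow> nat) \<Rightarrow> (nat \<Rightarrow> bool) \<Rightarrow> nat set" where
  "inspected m \<sigma> \<tau> F = {j. j < m \<and> 0 < \<sigma> j \<and> \<not> (\<exists>k<m. F k \<and> before \<sigma> \<tau> k j)}"

definition transacts :: "nat \<Rightarrow> (nat \<Rightarrow> real) \<Rightarrow> (nat \<Rightarrow> nat) \<Rightarrow> (nat \<Rightarrow> bool) \<Rightarrow> nat \<Rightarrow> bool" where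
  "transacts m \<sigma> \<tau> F j \<longleftrightarrow> j \<in> inspected m \<sigma> \<tau> F \<and> F j"


subsection \<open>Beliefs\<close>

type_synonym belief = "(real \<times> real) measure"

definition fit_mean :: "belief \<Rightarrow> real" where
  "fit_mean B = (\<integral>x. fst x \<partial>B)"

definition qual_mean :: "belief \<Rightarrow> real" where
  "qual_mean B = (\<integral>x. snd x \<partial>B)"

definition obs_fit :: "history \<Rightarrow> nat \<Rightarrow> nat \<Rightarrow> bool \<Rightarrow> nat" where
  "obs_fit H i j b = card {k. k < i \<and> fst (snd (H k)) j = Some b}"

definition obs_qual :: "history \<Rightarrow> nat \<Rightarrow> nat \<Rightarrow> bool \<Rightarrow> nat" where
  "obs_qual H i j b = card {k. k < i \<and> snd (snd (H k)) = Some (j, b)}"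

text \<open>
  Posterior of \<open>(\<pi>\<^sub>j, Q\<^sub>j)\<close> given the history of the rounds \<open>{..<i}\<close>, by Bayes' rule. Given the
  past, the current prices and the consumer's value and ranking, the order of inspection does not
  depend on the parameters, and nothing is inferred from prices; hence the likelihood of the
  history as a function of \<open>j\<close>'s parameters is that of the observed Bernoulli outcomes of \<open>j\<close>.
\<close>

definition likelihood :: "history \<Rightarrow> nat \<Rightarrow> nat \<Rightarrow> real \<times> real \<Rightarrow> real" where
  "likelihood H i j = (\<lambda>(a, b). a ^ obs_fit H i j True * (1 - a) ^ obs_fit H i j False *
     b ^ obs_qual H i j True * (1 - b) ^ obs_qual H i j False)"

definition posterior :: "market \<Rightarrow> nat \<Rightarrow> history \<Rightarrow> nat \<Rightarrow> belief" where
  "posterior M i H j =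
     (let prior = prior_fit M j \<Otimes>\<^sub>M prior_qual M j
      in density prior (\<lambda>x. ennreal (likelihood H i j x / (\<integral>y. likelihood H i j y \<partial>prior))))"


subsection \<open>Markets and their dynamics\<close>

definition hist_space :: "market \<Rightarrow> nat \<Rightarrow> history measure" where
  "hist_space M i = (\<Pi>\<^sub>M k\<in>{..<i}.
     (\<Pi>\<^sub>M j\<in>{..<nbiz M}. borel) \<Otimes>\<^sub>M count_space UNIV \<Otimes>\<^sub>M count_space UNIV)"

definition demand_responsive :: "market \<Rightarrow> nat \<Rightarrow> bool" where
  "demand_responsive M j \<longleftrightarrow> (\<forall>i. \<forall>H \<in> space (hist_space M i). \<forall>u \<in> {0..1}.
     let \<sigma> = (\<lambda>p. search_index (cost M) p
                (fit_mean (posterior M i H j)) (qual_mean (posterior M i H j)) (vbar M))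
     in (\<exists>p\<ge>0. 0 < \<sigma> p) \<longrightarrow> 0 < \<sigma> (price M j i H u))"

definition is_market :: "market \<Rightarrow> bool" where
  "is_market M \<longleftrightarrow>
     (\<forall>j < nbiz M. 0 < fitp M j \<and> fitp M j < 1 \<and> 0 \<le> qual M j \<and> qual M j \<le> 1) \<and>
     prob_space (valdist M) \<and> sets (valdist M) = sets borel \<and>
     (AE v in valdist M. 0 \<le> v \<and> v \<le> vbar M) \<and> regular_dist (valdist M) \<and>
     (\<forall>j < nbiz M.
        prob_space (prior_fit M j) \<and> sets (prior_fit M j) = sets borel \<and>
        (AE a in prior_fit M j. 0 < a \<and> a < 1) \<and> fitp M j \<in> msupport (prior_fit M j) \<and>
        prob_space (prior_qual M j) \<and> sets (prior_qual M j) = sets borel \<and>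
        (AE b in prior_qual M j. 0 \<le> b \<and> b \<le> 1) \<and> qual M j \<in> msupport (prior_qual M j)) \<and>
     0 \<le> cost M \<and>
     (\<forall>j < nbiz M. \<forall>i.
        (\<lambda>(H, u). price M j i H u) \<in> borel_measurable (hist_space M i \<Otimes>\<^sub>M borel) \<and>
        (\<forall>H \<in> space (hist_space M i). \<forall>u \<in> {0..1}. 0 \<le> price M j i H u)) \<and>
     (\<forall>j < nbiz M. demand_responsive M j) \<and>
     (\<forall>\<tau> \<in> set_pmf (tie M). inj_on \<tau> {..<nbiz M})"

text \<open>
  The randomness of one round: the consumer's value, the pricing seeds, the fits, the quality
  realizations, and the tie-breaking ranking. A market run is an i.i.d. sequence of these, and
  the history is a deterministic function of the run.
\<close>

type_synonym draw = "real \<times> (nat \<Rightarrow> real) \<times> (nat \<Rightarrow> bool) \<times> (nat \<Rightarrow> bool) \<times> (nat \<Rightarrow> nat)"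

definition fits_pmf :: "market \<Rightarrow> (nat \<Rightarrow> bool) pmf" where
  "fits_pmf M = Pi_pmf {..<nbiz M} False (\<lambda>j. bernoulli_pmf (fitp M j))"

definition quals_pmf :: "market \<Rightarrow> (nat \<Rightarrow> bool) pmf" where
  "quals_pmf M = Pi_pmf {..<nbiz M} False (\<lambda>j. bernoulli_pmf (qual M j))"

definition round_space :: "market \<Rightarrow> draw measure" where
  "round_space M = valdist M \<Otimes>\<^sub>M (\<Pi>\<^sub>M j\<in>{..<nbiz M}. uniform_measure lborel {0..1}) \<Otimes>\<^sub>M
     measure_pmf (pair_pmf (fits_pmf M) (pair_pmf (quals_pmf M) (tie M)))"

definition market_space :: "market \<Rightarrow> (nat \<Rightarrow> draw) measure" where
  "market_space M = (\<Pi>\<^sub>M i\<in>UNIV. round_space M)"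

definition play_round :: "market \<Rightarrow> nat \<Rightarrow> history \<Rightarrow> draw \<Rightarrow> round_record" where
  "play_round M i H = (\<lambda>(v, u, F, q, \<tau>).
     let m = nbiz M;
         P = (\<lambda>j\<in>{..<m}. price M j i H (u j));
         \<sigma> = (\<lambda>j. search_index (cost M) (P j)
                (fit_mean (posterior M i H j)) (qual_mean (posterior M i H j)) v)
     in (P,
         (\<lambda>j. if j \<in> inspected m \<sigma> \<tau> F then Some (F j) else None),
         (if \<exists>j. transacts m \<sigma> \<tau> F j
          then (let j = (THE j. transacts m \<sigma> \<tau> F j) in Some (j, q j)) else None)))"

primrec hist :: "market \<Rightarrow> (nat \<Rightarrow> draw) \<Rightarrow> nat \<Rightarrow> history" where
  "hist M \<omega> 0 = (\<lambda>_. undefined)"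
| "hist M \<omega> (Suc i) = (hist M \<omega> i)(i := play_round M i (hist M \<omega> i) (\<omega> i))"

text \<open>
  Along a run, the posterior is a random probability measure; \<open>j\<close> is learned on that run if a
  random variable with this law converges in probability to the true parameters.
\<close>

definition learned :: "market \<Rightarrow> (nat \<Rightarrow> draw) \<Rightarrow> nat \<Rightarrow> bool" where
  "learned M \<omega> j \<longleftrightarrow> (\<forall>\<epsilon>>0.
     (\<lambda>i. measure (posterior M i (hist M \<omega> i) j) {x. dist x (fitp M j, qual M j) > \<epsilon>})
       \<longlonglongrightarrow> 0)"

definition learned_set :: "market \<Rightarrow> (nat \<Rightarrow> draw) \<Rightarrow> nat set" where
  "learned_set M \<omega> = {j. j < nbiz M \<and> learned M \<omega> j}"

definition learned_symmetric :: "market \<Rightarrow> bool" where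
  "learned_symmetric M \<longleftrightarrow> (AE \<omega> in market_space M.
     \<forall>j \<in> learned_set M \<omega>. \<forall>k \<in> learned_set M \<omega>. fitp M j = fitp M k \<and> qual M j = qual M k)"


subsection \<open>Market equilibrium\<close>

definition true_belief :: "market \<Rightarrow> nat \<Rightarrow> belief" where
  "true_belief M j = return borel (fitp M j, qual M j)"

definition lost_belief :: "market \<Rightarrow> belief \<Rightarrow> bool" where
  "lost_belief M B \<longleftrightarrow> search_index (cost M) 0 (fit_mean B) (qual_mean B) (vbar M) \<le> 0"

text \<open>
  Expected revenue of \<open>j\<close> at price \<open>p\<close> when the other businesses draw their prices independently
  from \<open>\<Gamma>\<close>. The consumer ranks by her beliefs \<open>B\<close>, while fits follow the true probabilities.
\<close>

definition revenue :: "market \<Rightarrow> (nat \<Rightarrow> belief) \<Rightarrow> (nat \<Rightarrow> real measure) \<Rightarrow> nat \<Rightarrow> real \<Rightarrow> real" where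
  "revenue M B \<Gamma> j p = p * (\<integral>v. (\<integral>P.
       measure_pmf.prob (pair_pmf (fits_pmf M) (tie M))
         {(F, \<tau>). transacts (nbiz M)
            (\<lambda>k. search_index (cost M) (P k) (fit_mean (B k)) (qual_mean (B k)) v) \<tau> F j}
     \<partial>(\<Pi>\<^sub>M k\<in>{..<nbiz M}. (\<Gamma>(j := return borel p)) k)) \<partial>valdist M)"

definition expected_revenue ::
    "market \<Rightarrow> (nat \<Rightarrow> belief) \<Rightarrow> (nat \<Rightarrow> real measure) \<Rightarrow> nat \<Rightarrow> real" where
  "expected_revenue M B \<Gamma> j = (\<integral>p. revenue M B \<Gamma> j p \<partial>\<Gamma> j)"

definition market_equilibrium ::
    "market \<Rightarrow> (nat \<Rightarrow> belief) \<Rightarrow> (nat \<Rightarrow> real measure) \<Rightarrow> bool" where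
  "market_equilibrium M B \<Gamma> \<longleftrightarrow>
     (\<forall>j < nbiz M.
        prob_space (B j) \<and> sets (B j) = sets borel \<and>
        (AE x in B j. 0 < fst x \<and> fst x < 1 \<and> 0 \<le> snd x \<and> snd x \<le> 1) \<and>
        (B j = true_belief M j \<or> lost_belief M (B j))) \<and>
     (\<forall>j < nbiz M.
        prob_space (\<Gamma> j) \<and> sets (\<Gamma> j) = sets borel \<and> (AE p in \<Gamma> j. 0 \<le> p) \<and>
        (\<forall>p \<in> msupport (\<Gamma> j). \<forall>p'\<ge>0. revenue M B \<Gamma> j p' \<le> revenue M B \<Gamma> j p))"

definition eq_learned_set :: "market \<Rightarrow> (nat \<Rightarrow> belief) \<Rightarrow> nat set" where
  "eq_learned_set M B = {j. j < nbiz M \<and> B j = true_belief M j}"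

definition symmetric_equilibrium ::
    "market \<Rightarrow> nat set \<Rightarrow> (nat \<Rightarrow> belief) \<Rightarrow> (nat \<Rightarrow> real measure) \<Rightarrow> bool" where
  "symmetric_equilibrium M S B \<Gamma> \<longleftrightarrow>
     market_equilibrium M B \<Gamma> \<and> eq_learned_set M B = S \<and> (\<forall>j\<in>S. \<forall>k\<in>S. \<Gamma> j = \<Gamma> k)"

text \<open>
  Beliefs about and prices of lost businesses are not payoff-relevant: an equilibrium with
  learned set \<open>S\<close> is identified with its price distributions on \<open>S\<close>.
\<close>

definition symmetric_equilibrium_prices :: "market \<Rightarrow> nat set \<Rightarrow> (nat \<Rightarrow> real measure) set" where
  "symmetric_equilibrium_prices M S = {restrict \<Gamma> S | B \<Gamma>. symmetric_equilibrium M S B \<Gamma>}"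


subsection \<open>Monopoly benchmark\<close>

definition demand :: "market \<Rightarrow> real \<Rightarrow> real \<Rightarrow> real \<Rightarrow> real" where
  "demand M \<pi> Q p = measure (measure_pmf (bernoulli_pmf \<pi>) \<Otimes>\<^sub>M valdist M)
     {(F, v). p < (if F then v * Q - cost M / \<pi> else 0)}"

definition opt_revenue :: "market \<Rightarrow> real \<Rightarrow> real \<Rightarrow> real" where
  "opt_revenue M \<pi> Q = (SUP p\<in>{0..}. p * demand M \<pi> Q p)"

definition monopoly_price :: "market \<Rightarrow> real \<Rightarrow> real \<Rightarrow> real \<Rightarrow> bool" where
  "monopoly_price M \<pi> Q p \<longleftrightarrow> 0 \<le> p \<and> p * demand M \<pi> Q p = opt_revenue M \<pi> Q"

definition eq_cdf :: "market \<Rightarrow> real \<Rightarrow> real \<Rightarrow> nat \<Rightarrow> real \<Rightarrow> real \<Rightarrow> real" where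
  "eq_cdf M \<pi> Q n pstar p = 1 / \<pi> *
     (1 - (1 - \<pi>) *
        (pstar * demand M \<pi> Q pstar / (p * demand M \<pi> Q p)) powr (1 / (real n - 1)))"

text \<open>
  The lower end is the largest zero of the CDF formula on \<open>{0..pstar}\<close>, the range on which it
  is used. (Beyond \<open>pstar\<close> the formula decreases again and has further zeros.)
\<close>

definition is_lower_price :: "market \<Rightarrow> real \<Rightarrow> real \<Rightarrow> nat \<Rightarrow> real \<Rightarrow> real \<Rightarrow> bool" where
  "is_lower_price M \<pi> Q n pstar plow \<longleftrightarrow>
     plow \<in> {0..pstar} \<and> eq_cdf M \<pi> Q n pstar plow = 0 \<and>
     (\<forall>p \<in> {0..pstar}. eq_cdf M \<pi> Q n pstar p = 0 \<longrightarrow> p \<le> plow)"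

text \<open>
  For two or more sellers, the distribution is concentrated on \<open>{plow..pstar}\<close> with the given CDF.
  For a single seller the exponent \<open>1 / (n - 1)\<close> is read as \<open>\<infinity>\<close>: all mass sits at \<open>pstar\<close>.
\<close>

definition has_eq_price_law ::
    "market \<Rightarrow> real \<Rightarrow> real \<Rightarrow> nat \<Rightarrow> real \<Rightarrow> real measure \<Rightarrow> bool" where
  "has_eq_price_law M \<pi> Q n pstar N \<longleftrightarrow>
     (if n = 1 then N = return borel pstar
      else \<exists>plow. is_lower_price M \<pi> Q n pstar plow \<and> measure N {plow..pstar} = 1 \<and>
             (\<forall>p \<in> {plow..pstar}. cdf N p = eq_cdf M \<pi> Q n pstar p))"

end

theory Submission
  imports Defs
begin

text \<open>
  Regularity of the value distribution means that \<open>1 / (1 - cdf)\<close> is convex: the virtual value at a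
  point provides a supporting line. Hence the monopoly revenue \<open>R\<close> is strictly increasing until it
  reaches its maximum. Among equal learned businesses a price \<open>p\<close> earns \<open>R p\<close> times the probability
  that no cheaper rival fits. Undercutting excludes atoms in a symmetric equilibrium with at least
  two businesses, so this probability is \<open>(1 - \<pi> G p) ^ (n - 1)\<close>. At the top of the support all
  rivals are cheaper, which forces the common revenue \<open>(1 - \<pi>) ^ (n - 1) R\<^sup>*\<close>, and solving the
  indifference condition for \<open>G\<close> gives the formula. Beliefs about the businesses that were not
  learned can always be taken to be lost: put all mass at quality \<open>0\<close>.
\<close>

subsection \<open>Regular distributions\<close>

text \<open>The obstacle is that the density is merely measurable, so neither the cdf nor the
  revenue curve can be differentiated, although regularity is a pointwise condition on one version
  of the density. The first-order argument is therefore run on finite increments, with errors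
  quadratic in the step length.

  Regularity allows \<open>R\<close> to be constant on an interval of monopoly prices. With two or
  more businesses this is harmless, since the formula already reaches 1 at the smallest monopoly
  price. A single business could randomize freely over that interval, so for \<open>n = 1\<close>
  uniqueness is claimed under a unique monopoly price. If \<open>opt_revenue\<close> were 0, every
  price would earn nothing and every law on nonnegative prices would be a best reply; hence the
  positivity premise.

  Equilibrium conditions speak about support points only. They are carried to other prices by the
  leftmost point with the same cdf value, which lies in the support.\<close>

text \<open>Replaces a nonpositive derivative: over \<open>n\<close> equal steps the errors
  telescope to a total of \<open>C * (b - a)^2 / n\<close>, which vanishes in the limit.\<close>

lemma antimono_if_quadratic_increments:
  fixes f :: "real \<Rightarrow> real"
  assumes "a \<le> b"
    and inc: "\<And>x y. a \<le> x \<Longrightarrow> x \<le> y \<Longrightarrow> y \<le> b \<Longrightarrow> f y - f x \<le> C * (y - x)\<^sup>2"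
  shows "f b \<le> f a"
proof -
  have bound: "f b - f a \<le> C * (b - a)\<^sup>2 / real n" if "n > 0" for n
  proof -
    define x where "x i = a + real i * ((b - a) / real n)" for i
    have step: "f (x (Suc i)) - f (x i) \<le> C * ((b - a) / real n)\<^sup>2" if "i < n" for i
    proof -
      have diff: "x (Suc i) - x i = (b - a) / real n"
        by (simp add: x_def distrib_right add_divide_distrib)
      have "x (Suc i) \<le> a + real n * ((b - a) / real n)"
        unfolding x_def using \<open>a \<le> b\<close> that
        by (intro add_left_mono mult_right_mono) auto
      moreover have "a \<le> x i"
        using \<open>a \<le> b\<close> by (simp add: x_def)
      moreover have "0 \<le> x (Suc i) - x i"
        unfolding diff using \<open>a \<le> b\<close> by simp
      moreover have "a + real n * ((b - a) / real n) = b"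
        using \<open>n > 0\<close> by simp
      ultimately have "f (x (Suc i)) - f (x i) \<le> C * (x (Suc i) - x i)\<^sup>2"
        using inc[of "x i" "x (Suc i)"]  by simp
      then show ?thesis unfolding diff .
    qed
    have "f b - f a = f (x n) - f (x 0)"
      using \<open>n > 0\<close> by (simp add: x_def)
    also have "\<dots> = (\<Sum>i<n. f (x (Suc i)) - f (x i))"
      by (rule sum_lessThan_telescope[symmetric])
    also have "\<dots> \<le> (\<Sum>i<n. C * ((b - a) / real n)\<^sup>2)"
      by (intro sum_mono step) auto
    also have "\<dots> = C * (b - a)\<^sup>2 / real n"
      using \<open>n > 0\<close> by (simp add: power2_eq_square)
    finally show ?thesis .
  qed
  have "(\<lambda>n. C * (b - a)\<^sup>2 / real n) \<longlonglongrightarrow> 0"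
    by (rule lim_const_over_n)
  moreover have "\<forall>\<^sub>F n in sequentially. f b - f a \<le> C * (b - a)\<^sup>2 / real n"
    using bound by (intro eventually_sequentiallyI[of 1]) simp
  ultimately have "f b - f a \<le> 0"
    by (rule tendsto_lowerbound) simp
  then show ?thesis by simp
qed

lemma real_distributionI:
  "prob_space N \<Longrightarrow> sets N = sets borel \<Longrightarrow> real_distribution N"
  by (intro real_distribution.intro real_distribution_axioms.intro)

section \<open>Convexity of the reciprocal survival function\<close>

text \<open>Fixing a version \<open>\<psi>\<close> of the density gives the virtual value a meaning
  at each point. The cdf sees \<open>\<psi>\<close> only through integrals, so pointwise bounds on
  an interval are turned into bounds on cdf increments.\<close>

locale density_distribution =
  fixes D :: "real measure" and \<psi> :: "real \<Rightarrow> real"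
  assumes prob: "prob_space D"
    and meas: "\<psi> \<in> borel_measurable borel" and nonneg: "0 \<le> \<psi> v"
    and dens: "D = density lborel (\<lambda>v. ennreal (\<psi> v))"
begin

sublocale real_distribution D
  using prob by (auto simp: real_distribution_def real_distribution_axioms_def dens)

lemma emeasure_Ioc:
  "emeasure D {x<..y} = (\<integral>\<^sup>+t. ennreal (\<psi> t) * indicator {x<..y} t \<partial>lborel)"
  unfolding dens using meas by (subst emeasure_density) auto

lemma emeasure_Ioc_eq_cdf: "x \<le> y \<Longrightarrow> emeasure D {x<..y} = ennreal (cdf D y - cdf D x)"
  using cdf_diff_eq[of x y] by (cases "x = y") (auto simp: emeasure_eq_measure)

lemma cdf_increment_ge:
  assumes "x \<le> y" "0 \<le> b" "\<And>t. x < t \<Longrightarrow> t \<le> y \<Longrightarrow> b \<le> \<psi> t"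
  shows "b * (y - x) \<le> cdf D y - cdf D x"
proof -
  have "ennreal (b * (y - x)) = (\<integral>\<^sup>+t. ennreal b * indicator {x<..y} t \<partial>lborel)"
    using assms by (simp add: nn_integral_cmult_indicator ennreal_mult)
  also have "\<dots> \<le> emeasure D {x<..y}"
    unfolding emeasure_Ioc using assms
    by (intro nn_integral_mono) (auto simp: indicator_def intro: ennreal_leI)
  also have "\<dots> = ennreal (cdf D y - cdf D x)"
    using assms by (simp add: emeasure_Ioc_eq_cdf)
  finally show ?thesis
    using assms cdf_nondecreasing[of x y] by (simp add: ennreal_le_iff)
qed

lemma cdf_increment_le:
  assumes "x \<le> y" "0 \<le> b" "\<And>t. x < t \<Longrightarrow> t \<le> y \<Longrightarrow> \<psi> t \<le> b"
  shows "cdf D y - cdf D x \<le> b * (y - x)"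
proof -
  have "ennreal (cdf D y - cdf D x) = emeasure D {x<..y}"
    using assms by (simp add: emeasure_Ioc_eq_cdf)
  also have "\<dots> \<le> (\<integral>\<^sup>+t. ennreal b * indicator {x<..y} t \<partial>lborel)"
    unfolding emeasure_Ioc using assms
    by (intro nn_integral_mono) (auto simp: indicator_def intro: ennreal_leI)
  also have "\<dots> = ennreal (b * (y - x))"
    using assms by (simp add: nn_integral_cmult_indicator ennreal_mult)
  finally show ?thesis
    using assms by (subst (asm) ennreal_le_iff) auto
qed

lemma isCont_cdf_density: "isCont (cdf D) x"
proof -
  have "emeasure D {x} = 0"
    unfolding dens using meas
    by (subst emeasure_density) (auto simp: nn_integral_indicator_singleton)
  then show ?thesis by (simp add: isCont_cdf measure_def)
qed

text \<open>Regularity is silent where the cdf is 0. This yields points further left at which the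
  cdf is small but still positive.\<close>

lemma cdf_lower_IVT:
  assumes "0 < c" "c \<le> cdf D y"
  obtains x where "x \<le> y" "cdf D x = c"
proof -
  have "\<forall>\<^sub>F x in at_bot. cdf D x < c"
    by (rule order_tendstoD(2)[OF cdf_lim_at_bot assms(1)])
  then obtain z where "\<And>x. x \<le> z \<Longrightarrow> cdf D x < c"
    by (auto simp: eventually_at_bot_linorder)
  then have z: "cdf D (min z y) \<le> c" by (simp add: less_imp_le)
  obtain x where "min z y \<le> x" "x \<le> y" "cdf D x = c"
    using IVT[of "cdf D" "min z y" c y] z assms isCont_cdf_density by auto
  then show ?thesis using that by blast
qed

text \<open>
  Equivalently, \<open>1 / (1 - cdf D)\<close> is convex; \<open>k\<close> is the virtual value of \<open>v0\<close>.
\<close>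

lemma regular_supporting_line:
  assumes mono: "mono_on {v. 0 < cdf D v \<and> cdf D v < 1}
          (\<lambda>v. ereal v - ereal (1 - cdf D v) / ereal (\<psi> v))"
    and v0: "0 < cdf D v0" "cdf D v0 < 1"
  shows "\<exists>k<v0. \<forall>v. (v - k) * (1 - cdf D v) \<le> (v0 - k) * (1 - cdf D v0)"
proof -
  define S where "S v = 1 - cdf D v" for v
  have S_anti: "S y \<le> S x" if "x \<le> y" for x y
    using cdf_nondecreasing[OF that] by (simp add: S_def)
  have S_bounds: "0 \<le> S x" "S x \<le> 1" for x
    using cdf_bounded_prob[of x] cdf_nonneg[of x] by (simp_all add: S_def)
  have virt_zero: "ereal v - ereal (1 - cdf D v) / ereal (\<psi> v) = - \<infinity>"
    if "cdf D v < 1" "\<psi> v = 0" for v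
    using that by (simp add: divide_ereal_def zero_ereal_def[symmetric])
  have virt_pos: "ereal v - ereal (1 - cdf D v) / ereal (\<psi> v) = ereal (v - S v / \<psi> v)"
    if "0 < \<psi> v" for v
    using that by (simp add: S_def)
  have mono': "ereal u - ereal (1 - cdf D u) / ereal (\<psi> u)
      \<le> ereal v - ereal (1 - cdf D v) / ereal (\<psi> v)"
    if "0 < cdf D u" "u \<le> v" "cdf D v < 1" for u v
    using mono_onD[OF mono, of u v] that cdf_nondecreasing[of u v] by force
  \<comment> \<open>If \<open>\<psi> v0 = 0\<close>, the virtual value is
    \<open>- \<infinity>\<close> at \<open>v0\<close> and, by monotonicity, at all earlier points of
    positive cdf. The density would vanish there and the cdf could not grow from half of
    \<open>cdf D v0\<close> to \<open>cdf D v0\<close>.\<close>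
  have pos0: "0 < \<psi> v0"
  proof (rule ccontr)
    assume "\<not> 0 < \<psi> v0"
    then have z: "\<psi> v0 = 0" using nonneg[of v0] by simp
    obtain u where u: "u \<le> v0" "cdf D u = cdf D v0 / 2"
      using cdf_lower_IVT[of "cdf D v0 / 2" v0] v0 by auto
    have "\<psi> t = 0" if t: "u < t" "t \<le> v0" for t
    proof (rule ccontr)
      assume "\<psi> t \<noteq> 0"
      then have "0 < \<psi> t" using nonneg[of t] by simp
      then show False
        using mono'[of t v0] virt_pos[of t] virt_zero[of v0] z v0 t u cdf_nondecreasing[of u t]
        by simp
    qed
    then have "cdf D v0 - cdf D u \<le> 0 * (v0 - u)"
      using u by (intro cdf_increment_le) auto
    then show False using u v0 by simp
  qed
  \<comment> \<open>Formally \<open>1 / S\<close> has slope \<open>\<psi> v0 / (S v0)^2\<close> at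
    \<open>v0\<close>, and \<open>k\<close> is the zero of this tangent.\<close>
  define k where "k = v0 - S v0 / \<psi> v0"
  have "k < v0" using pos0 v0 by (simp add: k_def S_def)
  \<comment> \<open>Formally, \<open>right\<close> and \<open>left\<close> give the sign of the
    derivative \<open>S t - (t - k) * \<psi> t\<close> of \<open>(t - k) * S t\<close>: nonpositive
    above \<open>v0\<close> and nonnegative below.\<close>
  have right: "S t \<le> (t - k) * \<psi> t" if "v0 \<le> t" "cdf D t < 1" for t
  proof -
    have "ereal k \<le> ereal t - ereal (1 - cdf D t) / ereal (\<psi> t)"
      using mono'[of v0 t] that v0 virt_pos[OF pos0] by (simp add: k_def)
    moreover from this have "0 < \<psi> t"
      using virt_zero[of t] nonneg[of t] that by (cases "\<psi> t = 0") auto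
    ultimately show ?thesis
      using virt_pos[of t] by (simp add: field_simps)
  qed
  have left: "(t - k) * \<psi> t \<le> S t" if "t \<le> v0" "0 < cdf D t" for t
  proof (cases "\<psi> t = 0")
    case True
    then show ?thesis using S_bounds by simp
  next
    case False
    then have "0 < \<psi> t" using nonneg[of t] by simp
    moreover have "ereal t - ereal (1 - cdf D t) / ereal (\<psi> t) \<le> ereal k"
      using mono'[of t v0] that v0 virt_pos[OF pos0] by (simp add: k_def)
    ultimately show ?thesis
      using virt_pos[of t] by (simp add: field_simps)
  qed
  have main_right: "(v - k) * S v \<le> (v0 - k) * S v0" if "v0 \<le> v" "cdf D v < 1" for v
  proof (rule antimono_if_quadratic_increments[where C = "1 / (v0 - k)"
      and f = "\<lambda>v. (v - k) * S v" and a = v0 and b = v])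
    fix x y assume xy: "v0 \<le> x" "x \<le> y" "y \<le> v"
    have "cdf D t < 1" if "t \<le> v" for t
      using cdf_nondecreasing[OF that] \<open>cdf D v < 1\<close> by simp
    \<comment> \<open>\<open>S t / (t - k)\<close> is nonincreasing in \<open>t\<close>, so its
      value at the right end bounds \<open>\<psi>\<close> from below on the whole step. Freezing it
      there costs an error of second order in \<open>y - x\<close>. In \<open>main_left\<close> the
      left end gives an upper bound in the same way.\<close>
    then have "S y / (y - k) \<le> \<psi> t" if "x < t" "t \<le> y" for t
    proof -
      have "S y / (y - k) \<le> S t / (t - k)"
        using that xy \<open>k < v0\<close> S_anti S_bounds by (intro frac_le) auto
      also have "\<dots> \<le> \<psi> t"
        using right[of t] that xy \<open>k < v0\<close> \<open>\<And>t. t \<le> v \<Longrightarrow> cdf D t < 1\<close>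
        by (simp add: field_simps)
      finally show ?thesis .
    qed
    then have "S y / (y - k) * (y - x) \<le> S x - S y"
      using cdf_increment_ge[of x y "S y / (y - k)"] xy \<open>k < v0\<close> S_bounds
      by (simp add: S_def)
    then have "(x - k) * (S y / (y - k) * (y - x)) \<le> (x - k) * (S x - S y)"
      using xy \<open>k < v0\<close> by (intro mult_left_mono) auto
    moreover have "(x - k) * (S y / (y - k) * (y - x)) = S y * (y - x) - S y * (y - x)\<^sup>2 / (y - k)"
      using xy \<open>k < v0\<close> by (simp add: field_simps power2_eq_square)
    moreover have "S y * (y - x)\<^sup>2 / (y - k) \<le> 1 * (y - x)\<^sup>2 / (v0 - k)"
      using xy \<open>k < v0\<close> S_bounds by (intro frac_le mult_right_mono) auto
    ultimately show "(y - k) * S y - (x - k) * S x \<le> 1 / (v0 - k) * (y - x)\<^sup>2"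
      by (simp add: algebra_simps)
  qed fact
  have main_left: "(v - k) * S v \<le> (v0 - k) * S v0"
    if "v \<le> v0" "0 < cdf D v" "k < v" for v
  proof -
    have "- ((v0 - k) * S v0) \<le> - ((v - k) * S v)"
    proof (rule antimono_if_quadratic_increments[where C = "1 / (v - k)"
        and f = "\<lambda>v. - ((v - k) * S v)" and a = v and b = v0])
      fix x y assume xy: "v \<le> x" "x \<le> y" "y \<le> v0"
      have pos: "0 < cdf D t" if "v \<le> t" for t
        using cdf_nondecreasing[OF that] \<open>0 < cdf D v\<close> by simp
      have "\<psi> t \<le> S x / (x - k)" if "x < t" "t \<le> y" for t
      proof -
        have "\<psi> t \<le> S t / (t - k)"
          using left[of t] pos[of t] that xy \<open>k < v\<close> by (simp add: field_simps)
        also have "\<dots> \<le> S x / (x - k)"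
          using that xy \<open>k < v\<close> S_anti S_bounds by (intro frac_le) auto
        finally show ?thesis .
      qed
      then have "S x - S y \<le> S x / (x - k) * (y - x)"
        using cdf_increment_le[of x y "S x / (x - k)"] xy \<open>k < v\<close> S_bounds
        by (simp add: S_def)
      then have "(y - k) * (S x - S y) \<le> (y - k) * (S x / (x - k) * (y - x))"
        using xy \<open>k < v\<close> by (intro mult_left_mono) auto
      moreover have "(y - k) * (S x / (x - k) * (y - x)) = S x * (y - x) + S x * (y - x)\<^sup>2 / (x - k)"
        using xy \<open>k < v\<close> by (simp add: field_simps power2_eq_square)
      moreover have "S x * (y - x)\<^sup>2 / (x - k) \<le> 1 * (y - x)\<^sup>2 / (v - k)"
        using xy \<open>k < v\<close> S_bounds by (intro frac_le mult_right_mono) auto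
      ultimately show "- ((y - k) * S y) - - ((x - k) * S x) \<le> 1 / (v - k) * (y - x)\<^sup>2"
        by (simp add: algebra_simps)
    qed fact
    then show ?thesis by simp
  qed
  have "(v - k) * S v \<le> (v0 - k) * S v0" for v
  proof -
    have rhs: "0 \<le> (v0 - k) * S v0" using \<open>k < v0\<close> S_bounds by simp
    consider "v0 \<le> v" "cdf D v < 1" | "cdf D v = 1" | "v \<le> k" | "v \<le> v0" "0 < cdf D v" "k < v"
      | "v \<le> v0" "cdf D v = 0" "k < v"
      using cdf_bounded_prob[of v] cdf_nonneg[of v] by fastforce
    then show ?thesis
    proof cases
      case 2
      then show ?thesis using rhs by (simp add: S_def)
    next
      case 3
      then have "(v - k) * S v \<le> 0" using S_bounds by (simp add: mult_nonpos_nonneg)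
      then show ?thesis using rhs by simp
    next
      case 5
      \<comment> \<open>Below the range where regularity speaks, \<open>v\<close> is compared with a
        point \<open>u\<close> to its right whose cdf is positive but at most \<open>e\<close>; then
        \<open>e\<close> tends to 0.\<close>
      have "(1 - e) * (v - k) \<le> (v0 - k) * S v0" if e: "0 < e" "e < 1" for e
      proof -
        obtain u where u: "u \<le> v0" "cdf D u = min e (cdf D v0)"
          by (rule cdf_lower_IVT[of "min e (cdf D v0)" v0]) (use e v0 in auto)
        then have "0 < cdf D u" using e v0 by simp
        then have "v \<le> u" using 5 cdf_nondecreasing[of u v] by (cases "v \<le> u") auto
        have "(1 - e) * (v - k) \<le> S u * (u - k)"
          using \<open>v \<le> u\<close> 5 u e S_bounds by (intro mult_mono) (auto simp: S_def)
        also have "\<dots> = (u - k) * S u" by simp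
        also have "\<dots> \<le> (v0 - k) * S v0"
          using main_left[of u] u \<open>0 < cdf D u\<close> \<open>v \<le> u\<close> 5 by simp
        finally show ?thesis .
      qed
      then have "(v - k) \<le> (v0 - k) * S v0"
        using field_le_mult_one_interval[of "v - k"] by (metis diff_add_cancel diff_gt_0_iff_gt
          diff_diff_eq2 add_diff_cancel_left' less_add_same_cancel1 add.commute)
      then show ?thesis using 5 by (simp add: S_def)
    qed (use main_right main_left in auto)
  qed
  then show ?thesis using \<open>k < v0\<close> unfolding S_def by blast
qed

end

subsection \<open>The revenue curve of a learned business\<close>

text \<open>The realized learned set is frozen here, so all that follows is deterministic.
  \<open>opt_pos\<close> excludes a type for which every price is equally worthless.\<close>

locale learned_type =
  fixes M :: market and S :: "nat set" and \<pi> Q :: real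
  assumes market: "is_market M"
    and S_subset: "S \<subseteq> {..<nbiz M}" and S_nonempty: "S \<noteq> {}"
    and fitp_S: "j \<in> S \<Longrightarrow> fitp M j = \<pi>" and qual_S: "j \<in> S \<Longrightarrow> qual M j = Q"
    and opt_pos: "0 < opt_revenue M \<pi> Q"
begin

text \<open>Unlike \<open>demand\<close>, this never counts a consumer without a fit, even at
  negative prices. That is what the search rule produces; the two agree for nonnegative
  prices.\<close>

definition sale :: "real \<Rightarrow> real" where
  "sale p = \<pi> * measure (valdist M) {v. p < v * Q - cost M / \<pi>}"

definition R :: "real \<Rightarrow> real" where
  "R p = p * sale p"

abbreviation opt :: real where
  "opt \<equiv> opt_revenue M \<pi> Q"

lemma finite_S: "finite S"
  using S_subset finite_subset by blast

lemma \<pi>_bounds: "0 < \<pi>" "\<pi> < 1"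
  proof -
  obtain j where j: "j \<in> S" "j < nbiz M" using S_nonempty S_subset by auto
  then show "0 < \<pi>" "\<pi> < 1"
    using market fitp_S[of j] by (auto simp: is_market_def)
qed

lemma Q_nonneg: "0 \<le> Q" "Q \<le> 1"
  proof -
  obtain j where j: "j \<in> S" "j < nbiz M" using S_nonempty S_subset by auto
  then show "0 \<le> Q" "Q \<le> 1"
    using market qual_S[of j] by (auto simp: is_market_def)
qed

lemma cost_nonneg: "0 \<le> cost M"
  using market unfolding is_market_def by simp

lemma prob_valdist: "prob_space (valdist M)"
  using market unfolding is_market_def by simp

lemma sets_valdist [measurable_cong]: "sets (valdist M) = sets borel"
  using market unfolding is_market_def by simp

lemma AE_valdist: "AE v in valdist M. 0 \<le> v \<and> v \<le> vbar M"
  using market unfolding is_market_def by simp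

interpretation V: real_distribution "valdist M"
  by (rule real_distributionI[OF prob_valdist sets_valdist])

lemma demand_eq_sale: "0 \<le> p \<Longrightarrow> demand M \<pi> Q p = sale p"
proof -
  assume "0 \<le> p"
  interpret P: pair_prob_space "measure_pmf (bernoulli_pmf \<pi>)" "valdist M" ..
  have "{(F, v). p < (if F then v * Q - cost M / \<pi> else 0)} = {True} \<times> {v. p < v * Q - cost M / \<pi>}"
    using \<open>0 \<le> p\<close> by (auto split: if_splits)
  moreover have "{v. p < v * Q - cost M / \<pi>} \<in> sets (valdist M)"
    by measurable
  ultimately show ?thesis
    using \<pi>_bounds
    by (simp add: demand_def sale_def measure_def V.emeasure_pair_measure_Times enn2real_mult emeasure_pmf_single)
qed

lemma vbar_nonneg: "0 \<le> vbar M"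
proof -
  have "AE v in valdist M. 0 \<le> vbar M"
    using AE_valdist by eventually_elim simp
  then show ?thesis by simp
qed

lemma sale_zero: "vbar M \<le> p \<Longrightarrow> sale p = 0"
proof -
  assume p: "vbar M \<le> p"
  have "AE v in valdist M. \<not> p < v * Q - cost M / \<pi>"
    using AE_valdist
  proof eventually_elim
    fix v assume v: "0 \<le> v \<and> v \<le> vbar M"
    then have "v * Q \<le> vbar M * 1" using Q_nonneg by (intro mult_mono) auto
    moreover have "0 \<le> cost M / \<pi>" using cost_nonneg \<pi>_bounds by simp
    ultimately show "\<not> p < v * Q - cost M / \<pi>" using p by simp
  qed
  then have "measure (valdist M) {v. p < v * Q - cost M / \<pi>} = 0"
    by (subst V.prob_eq_0) auto
  then show ?thesis by (simp add: sale_def)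
qed

lemma sale_nonneg: "0 \<le> sale p"
  using \<pi>_bounds by (simp add: sale_def)

lemma sale_le: "sale p \<le> 1"
  using \<pi>_bounds by (auto simp: sale_def intro!: mult_le_one)

lemma bdd_above_revenue: "bdd_above ((\<lambda>p. p * demand M \<pi> Q p) ` {0..})"
proof (rule bdd_aboveI2)
  fix p :: real assume "p \<in> {0..}"
  then show "p * demand M \<pi> Q p \<le> vbar M"
    using sale_zero[of p] sale_le[of p] sale_nonneg[of p] vbar_nonneg
      mult_mono[of p "vbar M" "sale p" 1]
    by (cases "vbar M \<le> p") (auto simp: demand_eq_sale)
qed

lemma R_le_opt: "0 \<le> p \<Longrightarrow> R p \<le> opt"
  unfolding opt_revenue_def R_def
  by (rule cSUP_upper2[OF bdd_above_revenue]) (auto simp: demand_eq_sale)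

lemma Q_pos: "0 < Q"
proof (rule ccontr)
  assume "\<not> 0 < Q"
  then have "Q = 0" using Q_nonneg by simp
  then have "sale p = 0" if "0 \<le> p" for p
  proof -
    have "0 \<le> cost M / \<pi>" using cost_nonneg \<pi>_bounds by simp
    then have "{v. p < v * Q - cost M / \<pi>} = {}" using that \<open>Q = 0\<close> by auto
    then show ?thesis by (simp add: sale_def)
  qed
  then have "opt = 0"
    unfolding opt_revenue_def
    by (subst SUP_cong[OF refl, of _ _ "\<lambda>_. 0"]) (auto simp: demand_eq_sale)
  then show False using opt_pos by simp
qed

text \<open>The consumer value at which the index of a learned business charging \<open>p\<close> is
  exactly 0; it translates prices into values.\<close>

definition val :: "real \<Rightarrow> real" where
  "val p = (p + cost M / \<pi>) / Q"

lemma sale_eq_cdf: "sale p = \<pi> * (1 - cdf (valdist M) (val p))"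
proof -
  have "{v. p < v * Q - cost M / \<pi>} = UNIV - {..val p}"
    using Q_pos by (auto simp: val_def field_simps)
  then show ?thesis
    using V.prob_compl[of "{..val p}"] by (simp add: sale_def cdf_def)
qed

lemma valdist_density:
  obtains \<psi> where "density_distribution (valdist M) \<psi>"
    "mono_on {v. 0 < cdf (valdist M) v \<and> cdf (valdist M) v < 1}
          (\<lambda>v. ereal v - ereal (1 - cdf (valdist M) v) / ereal (\<psi> v))"
  using market prob_valdist unfolding is_market_def regular_dist_def density_distribution_def
  by blast

lemma isCont_sale: "isCont sale p"
proof -
  obtain \<psi> where "density_distribution (valdist M) \<psi>" by (rule valdist_density)
  then have "isCont (cdf (valdist M)) (val p)"
    by (rule density_distribution.isCont_cdf_density)
  moreover have "isCont val p"
    unfolding val_def using Q_pos by (intro continuous_intros) auto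
  ultimately have "isCont (\<lambda>p. cdf (valdist M) (val p)) p"
    by (rule isCont_o2[rotated])
  then show ?thesis
    unfolding sale_eq_cdf[abs_def] by (intro continuous_intros)
qed

lemma isCont_R: "isCont R p"
  unfolding R_def[abs_def] by (intro continuous_intros isCont_sale)

lemma monopoly_price_iff: "monopoly_price M \<pi> Q p \<longleftrightarrow> 0 \<le> p \<and> R p = opt"
  by (auto simp: monopoly_price_def R_def demand_eq_sale)

lemma ex_monopoly_price: "\<exists>p. monopoly_price M \<pi> Q p"
proof -
  have "continuous_on {0..vbar M} R"
    by (intro continuous_at_imp_continuous_on ballI isCont_R)
  then obtain p where p: "p \<in> {0..vbar M}" "\<And>q. q \<in> {0..vbar M} \<Longrightarrow> R q \<le> R p"
    using continuous_attains_sup[of "{0..vbar M}" R] vbar_nonneg by fastforce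
  have "R q \<le> R p" if "0 \<le> q" for q
  proof (cases "q \<le> vbar M")
    case False
    then show ?thesis using sale_zero[of q] sale_nonneg[of p] p(1) by (simp add: R_def)
  qed (use p(2) that in auto)
  then have "opt \<le> R p"
    unfolding opt_revenue_def
    by (intro cSUP_least) (auto simp: demand_eq_sale R_def)
  then have "monopoly_price M \<pi> Q p"
    using R_le_opt[of p] p(1) by (auto simp: monopoly_price_iff)
  then show ?thesis ..
qed

section \<open>Monotonicity of revenue up to its maximum\<close>

text \<open>In terms of \<open>v = val p\<close>, revenue is proportional to
  \<open>(v - c0) * T v\<close>, while the supporting line at \<open>val b\<close> controls
  \<open>(v - k) * T v\<close>. A rise after \<open>b\<close> is possible only if
  \<open>k < c0\<close>. Passing from \<open>k\<close> to \<open>c0\<close> subtracts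
  \<open>(c0 - k) * T v\<close>, which is larger at \<open>a\<close> than at \<open>b\<close> unless
  \<open>T\<close> agrees at both.\<close>

lemma R_quasiconcave:
  assumes "0 \<le> a" "a < b" "b < c" "R b < R c"
  shows "R a < R b"
proof -
  obtain \<psi> where dd: "density_distribution (valdist M) \<psi>" and
    mono: "mono_on {v. 0 < cdf (valdist M) v \<and> cdf (valdist M) v < 1}
          (\<lambda>v. ereal v - ereal (1 - cdf (valdist M) v) / ereal (\<psi> v))"
    by (rule valdist_density)
  define T where "T v = 1 - cdf (valdist M) v" for v
  define c0 where "c0 = cost M / \<pi> / Q"
  have R_T: "R p = \<pi> * Q * ((val p - c0) * T (val p))" for p
    using Q_pos by (simp add: R_def sale_eq_cdf T_def val_def c0_def field_simps)
  have "0 < \<pi> * Q" using \<pi>_bounds Q_pos by simp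
  have val_less: "val p < val q" if "p < q" for p q
    using that Q_pos by (simp add: val_def divide_strict_right_mono)
  have T_anti: "T w \<le> T v" if "v \<le> w" for v w
    using V.cdf_nondecreasing[OF that] by (simp add: T_def)
  have T_bounds: "0 \<le> T v" "T v \<le> 1" for v
    using V.cdf_bounded_prob[of v] V.cdf_nonneg[of v] by (simp_all add: T_def)
  \<comment> \<open>The supporting line exists only where the cdf lies strictly between 0 and 1. If
    \<open>T\<close> vanishes at \<open>val b\<close>, revenue is 0 at both \<open>b\<close> and
    \<open>c\<close>; if \<open>T\<close> is 1 there, revenue is linear from \<open>a\<close> to
    \<open>b\<close>.\<close>
  consider "T (val b) = 0" | "T (val b) = 1" | "0 < T (val b)" "T (val b) < 1"
    using T_bounds[of "val b"] by fastforce
  then show ?thesis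
  proof cases
    case 1
    then have "T (val c) = 0"
      using T_anti[of "val b" "val c"] T_bounds(1)[of "val c"] val_less[OF assms(3)] by simp
    then show ?thesis using assms 1 by (simp add: R_T)
  next
    case 2
    then have "T (val a) = 1"
      using T_anti[of "val a" "val b"] T_bounds(2)[of "val a"] val_less[OF assms(2)] by simp
    then show ?thesis
      unfolding R_T using 2 val_less[OF assms(2)] \<open>0 < \<pi> * Q\<close>
      by (intro mult_strict_left_mono) auto
  next
    case 3
    then obtain k where k: "k < val b" "\<And>v. (v - k) * T v \<le> (val b - k) * T (val b)"
      using density_distribution.regular_supporting_line[OF dd mono, of "val b"]
      by (auto simp: T_def)
    have "k < c0"
    proof (rule ccontr)
      assume "\<not> k < c0"
      then have "(k - c0) * T (val c) \<le> (k - c0) * T (val b)"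
        using T_anti[of "val b" "val c"] val_less[OF assms(3)] by (intro mult_left_mono) auto
      then have "(val c - c0) * T (val c) \<le> (val b - c0) * T (val b)"
        using k(2)[of "val c"] by (simp add: algebra_simps)
      then have "R c \<le> R b"
        unfolding R_T using \<open>0 < \<pi> * Q\<close> by (intro mult_left_mono) auto
      then show False using assms(4) by simp
    qed
    have "(val a - c0) * T (val a) < (val b - c0) * T (val b)"
    proof (cases "T (val a) = T (val b)")
      case True
      then show ?thesis using 3 val_less[OF assms(2)] by simp
    next
      case False
      then have "T (val b) < T (val a)"
        using T_anti[of "val a" "val b"] val_less[OF assms(2)] by simp
      then have "(c0 - k) * T (val b) < (c0 - k) * T (val a)"
        using \<open>k < c0\<close> by simp
      then show ?thesis
        using k(2)[of "val a"] by (simp add: algebra_simps)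
    qed
    then show ?thesis
      unfolding R_T using \<open>0 < \<pi> * Q\<close> by (intro mult_strict_left_mono)
  qed
qed

lemma R_mono:
  assumes "monopoly_price M \<pi> Q pstar" "0 \<le> a" "a \<le> b" "b \<le> pstar"
  shows "R a \<le> R b"
proof (cases "R b = opt \<or> a = b")
  case True
  then show ?thesis using R_le_opt[of a] assms by auto
next
  case False
  then have "R b < R pstar" "a < b"
    using R_le_opt[of b] assms by (auto simp: monopoly_price_iff)
  moreover from this have "b < pstar" using assms by (cases "b = pstar") auto
  ultimately show ?thesis using R_quasiconcave[of a b pstar] assms by simp
qed

text \<open>Strictness is restricted to levels below \<open>opt\<close>, because the maximum may be
  attained on a whole interval.\<close>

lemma R_strict_mono:
  assumes "monopoly_price M \<pi> Q pstar" "0 \<le> a" "a < b" "b \<le> pstar" "R b < opt"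
  shows "R a < R b"
proof -
  have "b < pstar" using assms by (cases "b = pstar") (auto simp: monopoly_price_iff)
  then show ?thesis using R_quasiconcave[of a b pstar] assms by (simp add: monopoly_price_iff)
qed

end

subsection \<open>Sales under competition\<close>

lemma prob_pair_pmf_Collect:
  "measure_pmf.prob (pair_pmf A B) {(x, y). P x y} =
     (\<integral>y. measure_pmf.prob A {x. P x y} \<partial>measure_pmf B)"
proof -
  have pair: "pair_pmf A B = bind_pmf B (\<lambda>y. map_pmf (\<lambda>x. (x, y)) A)"
    unfolding pair_pmf_def map_pmf_def by (rule bind_commute_pmf)
  have "ennreal (measure_pmf.prob (pair_pmf A B) {(x, y). P x y}) =
      (\<integral>\<^sup>+y. ennreal (measure_pmf.prob A {x. P x y}) \<partial>measure_pmf B)"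
    unfolding measure_pmf.emeasure_eq_measure[symmetric] pair
    by (auto simp: vimage_def)
  also have "\<dots> = ennreal (\<integral>y. measure_pmf.prob A {x. P x y} \<partial>measure_pmf B)"
    by (intro nn_integral_eq_integral measure_pmf.integrable_const_bound[of _ 1]) auto
  finally show ?thesis
    by (subst (asm) ennreal_inj) (auto intro!: integral_nonneg_AE)
qed

lemma integral_pmf_finite_range:
  fixes h :: "'a \<Rightarrow> real"
  assumes "finite A" "\<And>\<tau>. t \<tau> \<in> A"
  shows "(\<integral>\<tau>. h (t \<tau>) \<partial>measure_pmf q) = (\<Sum>a\<in>A. h a * pmf (map_pmf t q) a)"
proof -
  have "(\<integral>\<tau>. h (t \<tau>) \<partial>measure_pmf q) = (\<integral>a. h a \<partial>measure_pmf (map_pmf t q))"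
    by simp
  also have "\<dots> = (\<Sum>a\<in>A. h a * pmf (map_pmf t q) a)"
    using assms by (intro integral_measure_pmf_real) auto
  finally show ?thesis .
qed

text \<open>The ranking law may have infinite support, but only a statistic \<open>t \<tau>\<close>
  with finitely many values matters (the set of rivals ranked ahead). The exchange then reduces to
  that of a finite sum with an integral.\<close>

lemma integral_swap_pmf_finite:
  fixes g :: "'a \<Rightarrow> 'b \<Rightarrow> real" and q :: "'c pmf"
  assumes A: "finite A" "\<And>\<tau>. t \<tau> \<in> A" and int: "\<And>a. a \<in> A \<Longrightarrow> integrable N (g a)"
  shows "integrable N (\<lambda>x. \<integral>\<tau>. g (t \<tau>) x \<partial>measure_pmf q)"
    and "(\<integral>x. (\<integral>\<tau>. g (t \<tau>) x \<partial>measure_pmf q) \<partial>N) = (\<integral>\<tau>. (\<integral>x. g (t \<tau>) x \<partial>N) \<partial>measure_pmf q)"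
proof -
  have eq: "(\<integral>\<tau>. g (t \<tau>) x \<partial>measure_pmf q) = (\<Sum>a\<in>A. g a x * pmf (map_pmf t q) a)" for x
    using A by (rule integral_pmf_finite_range)
  show "integrable N (\<lambda>x. \<integral>\<tau>. g (t \<tau>) x \<partial>measure_pmf q)"
    unfolding eq using int by simp
  have "(\<integral>\<tau>. (\<integral>x. g (t \<tau>) x \<partial>N) \<partial>measure_pmf q) = (\<Sum>a\<in>A. integral\<^sup>L N (g a) * pmf (map_pmf t q) a)"
    using A by (rule integral_pmf_finite_range)
  then show "(\<integral>x. (\<integral>\<tau>. g (t \<tau>) x \<partial>measure_pmf q) \<partial>N) = (\<integral>\<tau>. (\<integral>x. g (t \<tau>) x \<partial>N) \<partial>measure_pmf q)"
    unfolding eq using int by simp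
qed

lemma transacts_iff:
  "transacts m \<sigma> \<tau> F j \<longleftrightarrow> j < m \<and> 0 < \<sigma> j \<and> F j \<and> \<not> (\<exists>k<m. F k \<and> before \<sigma> \<tau> k j)"
  by (auto simp: transacts_def inspected_def)

text \<open>The event depends on the indices only through the sign of \<open>\<sigma> j\<close> and
  its order relative to the others. There are finitely many such patterns \<open>s z\<close>, each
  on a measurable set of \<open>z\<close>.\<close>

lemma measurable_prob_transacts:
  assumes meas: "\<And>k. k < m \<Longrightarrow> (\<lambda>z. \<sigma> z k) \<in> borel_measurable X" and "j < m"
  shows "(\<lambda>z. measure_pmf.prob q {(F, \<tau>). transacts m (\<sigma> z) \<tau> F j}) \<in> borel_measurable X"
proof -
  define C where "C = (UNIV :: bool set) \<times> Pow {..<m} \<times> Pow {..<m}"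
  define s where "s z = (0 < \<sigma> z j, {k. k < m \<and> \<sigma> z j < \<sigma> z k}, {k. k < m \<and> \<sigma> z j = \<sigma> z k})" for z
  define h where "h = (\<lambda>(a, A, B). measure_pmf.prob q
    {(F, \<tau>). a \<and> F j \<and> \<not> (\<exists>k<m. F k \<and> (k \<in> A \<or> k \<in> B \<and> \<tau> k < \<tau> j))})"
  note meas[measurable] meas[OF \<open>j < m\<close>, measurable]
  have "s \<in> X \<rightarrow>\<^sub>M count_space C"
  proof (subst measurable_count_space_eq2)
    show "finite C" by (simp add: C_def)
    have "s -` {(a, A, B)} \<inter> space X \<in> sets X" if "A \<subseteq> {..<m}" "B \<subseteq> {..<m}" for a A B
    proof -
      have "s -` {(a, A, B)} \<inter> space X = {z \<in> space X. (0 < \<sigma> z j) = a \<and>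
          (\<forall>k\<in>{..<m}. (\<sigma> z j < \<sigma> z k) = (k \<in> A)) \<and> (\<forall>k\<in>{..<m}. (\<sigma> z j = \<sigma> z k) = (k \<in> B))}"
      proof -
        have "s z = (a, A, B) \<longleftrightarrow> (0 < \<sigma> z j) = a \<and>
            (\<forall>k\<in>{..<m}. (\<sigma> z j < \<sigma> z k) = (k \<in> A)) \<and> (\<forall>k\<in>{..<m}. (\<sigma> z j = \<sigma> z k) = (k \<in> B))" for z
          using that unfolding s_def prod.inject set_eq_iff mem_Collect_eq by blast
        then show ?thesis by blast
      qed
      also have "\<dots> \<in> sets X" by measurable
      finally show ?thesis .
    qed
    then show "s \<in> space X \<rightarrow> C \<and> (\<forall>a\<in>C. s -` {a} \<inter> space X \<in> sets X)"
      by (auto simp: C_def s_def)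
  qed
  then have "(\<lambda>z. h (s z)) \<in> borel_measurable X"
    by (rule measurable_compose) simp
  moreover have "h (s z) = measure_pmf.prob q {(F, \<tau>). transacts m (\<sigma> z) \<tau> F j}" for z
    using \<open>j < m\<close> unfolding h_def s_def transacts_iff before_def
    by (auto intro!: arg_cong[where f = "measure_pmf.prob q"])
  ultimately show ?thesis by simp
qed

section \<open>The revenue of a learned business in closed form\<close>

lemma prob_fits_pmf:
  assumes "is_market M" "j < nbiz M" "K \<subseteq> {..<nbiz M} - {j}"
  shows "measure_pmf.prob (fits_pmf M) {F. F j \<and> (\<forall>k\<in>K. \<not> F k)} =
    fitp M j * (\<Prod>k\<in>K. 1 - fitp M k)"
proof -
  define B where "B x = (if x = j then {True} else if x \<in> K then {False} else UNIV)" for x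
  have fitp: "0 \<le> fitp M x" "fitp M x \<le> 1" if "x < nbiz M" for x
    using assms(1) that unfolding is_market_def by (auto intro: less_imp_le)
  have prob_B: "measure_pmf.prob (bernoulli_pmf (fitp M x)) (B x) =
      (if x = j then fitp M x else if x \<in> K then 1 - fitp M x else 1)" if "x < nbiz M" for x
    using fitp[OF that] by (auto simp: B_def measure_pmf_single)
  have "{F. F j \<and> (\<forall>k\<in>K. \<not> F k)} = Pi {..<nbiz M} B"
    using assms by (fastforce simp: B_def Pi_iff split: if_splits)
  then have "measure_pmf.prob (fits_pmf M) {F. F j \<and> (\<forall>k\<in>K. \<not> F k)} =
      (\<Prod>x<nbiz M. measure_pmf.prob (bernoulli_pmf (fitp M x)) (B x))"
    unfolding fits_pmf_def by (simp add: measure_Pi_pmf_Pi)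
  also have "\<dots> = (\<Prod>x<nbiz M. if x = j then fitp M x else if x \<in> K then 1 - fitp M x else 1)"
    using prob_B by (intro prod.cong) auto
  also have "\<dots> = fitp M j * (\<Prod>x\<in>{..<nbiz M} - {j}. if x \<in> K then 1 - fitp M x else 1)"
    using assms(2) by (subst prod.remove[of _ j]) (auto intro!: prod.cong)
  also have "(\<Prod>x\<in>{..<nbiz M} - {j}. if x \<in> K then 1 - fitp M x else 1) = (\<Prod>k\<in>K. 1 - fitp M k)"
    using assms(3) by (intro prod.mono_neutral_cong_right) auto
  finally show ?thesis .
qed

context learned_type
begin

interpretation V: real_distribution "valdist M"
  by (rule real_distributionI[OF prob_valdist sets_valdist])

text \<open>A willing consumer gives \<open>j\<close> a positive index, so no lost business comes
  before \<open>j\<close>, and each learned rival ahead contributes an independent factor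
  \<open>1 - \<pi>\<close>. The product runs over the fixed set \<open>S - {j}\<close>, with factor
  1 for rivals behind, so that it factors again when independent prices are integrated out.\<close>

lemma prob_transacts:
  assumes "j \<in> S" and lost: "\<And>k. k < nbiz M \<Longrightarrow> k \<notin> S \<Longrightarrow> \<sigma> k \<le> 0"
    and learned: "\<And>k. k \<in> S \<Longrightarrow> \<sigma> k = x - P k"
  shows "measure_pmf.prob (pair_pmf (fits_pmf M) (tie M)) {(F, \<tau>). transacts (nbiz M) \<sigma> \<tau> F j} =
    (if P j < x then \<pi> * (\<integral>\<tau>. (\<Prod>k\<in>S - {j}.
       if P k < P j \<or> P k = P j \<and> \<tau> k < \<tau> j then 1 - \<pi> else 1) \<partial>measure_pmf (tie M)) else 0)"
proof (cases "P j < x")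
  case False
  then show ?thesis using learned[OF \<open>j \<in> S\<close>] by (simp add: transacts_iff)
next
  case True
  have "measure_pmf.prob (fits_pmf M) {F. transacts (nbiz M) \<sigma> \<tau> F j} =
      \<pi> * (\<Prod>k\<in>S - {j}. if P k < P j \<or> P k = P j \<and> \<tau> k < \<tau> j then 1 - \<pi> else 1)" for \<tau>
  proof -
    define K where "K = {k \<in> S - {j}. P k < P j \<or> P k = P j \<and> \<tau> k < \<tau> j}"
    have "before \<sigma> \<tau> k j \<longleftrightarrow> k \<in> K" if "k < nbiz M" for k
    proof (cases "k \<in> S")
      case True
      then show ?thesis using learned \<open>j \<in> S\<close> by (auto simp: before_def K_def)
    next
      case False
      then have "\<sigma> k < \<sigma> j"
        using lost[OF that] learned[OF \<open>j \<in> S\<close>] \<open>P j < x\<close> by simp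
      then show ?thesis using False by (simp add: before_def K_def)
    qed
    then have "{F. transacts (nbiz M) \<sigma> \<tau> F j} = {F. F j \<and> (\<forall>k\<in>K. \<not> F k)}"
      using True learned[OF \<open>j \<in> S\<close>] \<open>j \<in> S\<close> S_subset unfolding transacts_iff K_def by auto
    moreover have "K \<subseteq> {..<nbiz M} - {j}" "j < nbiz M"
      using S_subset \<open>j \<in> S\<close> by (auto simp: K_def)
    ultimately have "measure_pmf.prob (fits_pmf M) {F. transacts (nbiz M) \<sigma> \<tau> F j} =
        fitp M j * (\<Prod>k\<in>K. 1 - fitp M k)"
      using market by (simp add: prob_fits_pmf)
    also have "\<dots> = \<pi> * (\<Prod>k\<in>K. 1 - \<pi>)"
      using fitp_S \<open>j \<in> S\<close> by (auto simp: K_def intro!: prod.cong)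
    also have "(\<Prod>k\<in>K. 1 - \<pi>) =
        (\<Prod>k\<in>S - {j}. if P k < P j \<or> P k = P j \<and> \<tau> k < \<tau> j then 1 - \<pi> else 1)"
      using finite_S by (intro prod.mono_neutral_cong_left) (auto simp: K_def)
    finally show ?thesis .
  qed
  then show ?thesis using True by (simp add: prob_pair_pmf_Collect)
qed

text \<open>The probability that no rival ahead of \<open>j\<close> fits, when \<open>j\<close>
  charges \<open>p\<close> and rivals draw from \<open>N\<close>. The ranking is averaged outside
  the product because the events for different rivals are independent only given
  \<open>\<tau>\<close>.\<close>

definition win_prob :: "real measure \<Rightarrow> nat \<Rightarrow> real \<Rightarrow> real" where
  "win_prob N j p = (\<integral>\<tau>. (\<Prod>k\<in>S - {j}. 1 - \<pi> * measure N {x. x < p \<or> x = p \<and> \<tau> k < \<tau> j})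
     \<partial>measure_pmf (tie M))"

text \<open>
  Lost businesses have a nonpositive index whatever they charge, so \<open>j\<close> loses a willing consumer
  with a fit only to a learned rival that fits and comes earlier in price, or by the ranking at
  equal prices.
\<close>

lemma revenue_eq:
  assumes "j \<in> S"
    and learned: "\<And>k. k \<in> S \<Longrightarrow> fit_mean (B k) = \<pi> \<and> qual_mean (B k) = Q \<and> \<Gamma> k = N"
    and lost: "\<And>k. k < nbiz M \<Longrightarrow> k \<notin> S \<Longrightarrow> lost_belief M (B k) \<and> 0 \<le> qual_mean (B k)"
    and prices: "\<And>k. k < nbiz M \<Longrightarrow>
      prob_space (\<Gamma> k) \<and> sets (\<Gamma> k) = sets borel \<and> (AE p in \<Gamma> k. 0 \<le> p)"
  shows "revenue M B \<Gamma> j p = R p * win_prob N j p"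
proof -
  define m where "m = nbiz M"
  \<comment> \<open>The point masses beyond \<open>m\<close> are padding: the product locale over
    \<open>UNIV\<close> asks for a probability measure at every index.\<close>
  define \<Gamma>' where "\<Gamma>' k = (if k < m then (\<Gamma>(j := return borel p)) k else return borel 0)" for k
  define X where "X = (\<Pi>\<^sub>M k\<in>{..<m}. \<Gamma>' k)"
  define \<sigma> where "\<sigma> v P k = search_index (cost M) (P k) (fit_mean (B k)) (qual_mean (B k)) v" for v P k
  define f where "f v P = measure_pmf.prob (pair_pmf (fits_pmf M) (tie M))
    {(F, \<tau>). transacts m (\<sigma> v P) \<tau> F j}" for v P
  define w where "w T k y = (if y < p \<or> y = p \<and> k \<in> T then 1 - \<pi> else 1)" for T :: "nat set" and k y
  define t where "t \<tau> = {k \<in> S - {j}. \<tau> k < \<tau> j}" for \<tau> :: "nat \<Rightarrow> nat"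
  have "j < m" using \<open>j \<in> S\<close> S_subset by (auto simp: m_def)
  have \<Gamma>': "prob_space (\<Gamma>' k)" "sets (\<Gamma>' k) = sets borel" for k
    using prices by (auto simp: \<Gamma>'_def m_def prob_space_return)
  interpret \<Gamma>': product_prob_space \<Gamma>' UNIV
    by (intro product_prob_spaceI \<Gamma>')
  interpret X: prob_space X
    unfolding X_def by (intro prob_space_PiM \<Gamma>')
  have \<Gamma>'_S: "\<Gamma>' k = N" if "k \<in> S - {j}" for k
    using that learned S_subset by (auto simp: \<Gamma>'_def m_def)
  have meas_comp: "(\<lambda>P. P k) \<in> borel_measurable X" if "k < m" for k
  proof -
    have "(\<lambda>P. P k) \<in> X \<rightarrow>\<^sub>M \<Gamma>' k"
      unfolding X_def using that by (intro measurable_component_singleton) auto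
    then show ?thesis using \<Gamma>'(2) by (simp cong: measurable_cong_sets)
  qed
  have meas_f: "(\<lambda>(v, P). f v P) \<in> borel_measurable (borel \<Otimes>\<^sub>M X)"
  proof -
    have "(\<lambda>z. case z of (v, P) \<Rightarrow> \<sigma> v P k) \<in> borel_measurable (borel \<Otimes>\<^sub>M X)" if "k < m" for k
      using meas_comp[OF that] unfolding \<sigma>_def search_index_def by measurable
    then have "(\<lambda>z. measure_pmf.prob (pair_pmf (fits_pmf M) (tie M))
        {(F, \<tau>). transacts m (case z of (v, P) \<Rightarrow> \<sigma> v P) \<tau> F j}) \<in> borel_measurable (borel \<Otimes>\<^sub>M X)"
      by (intro measurable_prob_transacts \<open>j < m\<close>) (simp add: case_prod_beta)
    then show ?thesis by (simp add: f_def case_prod_beta)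
  qed
  have meas_f1: "f v \<in> borel_measurable X" for v
    using measurable_compose[OF measurable_Pair1' meas_f, of v] by simp
  have meas_int: "(\<lambda>v. \<integral>P. f v P \<partial>X) \<in> borel_measurable (valdist M)"
    using X.borel_measurable_lebesgue_integral[OF meas_f] sets_valdist
    by (simp cong: measurable_cong_sets)
  have AE_own: "AE P in X. P j = p"
  proof -
    have own: "\<Gamma>' j = return borel p"
      using \<open>j < m\<close> by (simp add: \<Gamma>'_def)
    have "AE y in \<Gamma>' j. y = p"
      unfolding own by (subst AE_return) auto
    then show ?thesis
      unfolding X_def using \<open>j < m\<close> \<Gamma>' by (intro AE_PiM_component[where i = j]) auto
  qed
  have AE_lost: "AE P in X. \<forall>k\<in>{..<m} - S. 0 \<le> P k"
  proof (intro eventually_ball_finite ballI)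
    fix k assume k: "k \<in> {..<m} - S"
    then have other: "\<Gamma>' k = \<Gamma> k"
      using \<open>j \<in> S\<close> by (auto simp: \<Gamma>'_def)
    have "AE y in \<Gamma>' k. 0 \<le> y"
      unfolding other using prices[of k] k by (simp add: m_def)
    then show "AE P in X. 0 \<le> P k"
      unfolding X_def using k \<Gamma>' by (intro AE_PiM_component[where i = k]) auto
  qed simp
  have int_w: "(\<integral>y. w T k y \<partial>\<Gamma>' k) = 1 - \<pi> * measure N {x. x < p \<or> x = p \<and> k \<in> T}"
    and integrable_w: "integrable (\<Gamma>' k) (w T k)" if "k \<in> S - {j}" for T k
  proof -
    interpret N: prob_space N using \<Gamma>'(1)[of k] \<Gamma>'_S[OF that] by simp
    have sets_N: "sets N = sets borel" using \<Gamma>'(2)[of k] \<Gamma>'_S[OF that] by simp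
    have A: "{x. x < p \<or> x = p \<and> k \<in> T} \<in> sets N"
      unfolding sets_N by measurable
    have w: "w T k = (\<lambda>y. 1 - \<pi> * indicator {x. x < p \<or> x = p \<and> k \<in> T} y)"
      by (auto simp: w_def)
    show "integrable (\<Gamma>' k) (w T k)"
      unfolding w \<Gamma>'_S[OF that] using A by (simp add: N.emeasure_eq_measure)
    show "(\<integral>y. w T k y \<partial>\<Gamma>' k) = 1 - \<pi> * measure N {x. x < p \<or> x = p \<and> k \<in> T}"
      unfolding w \<Gamma>'_S[OF that] using A N.prob_space
      by (simp add: N.emeasure_eq_measure)
  qed
  have int_prod: "(\<integral>P. (\<Prod>k\<in>S - {j}. w T k (P k)) \<partial>X) =
      (\<Prod>k\<in>S - {j}. 1 - \<pi> * measure N {x. x < p \<or> x = p \<and> k \<in> T})"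
    and integrable_prod: "integrable X (\<lambda>P. \<Prod>k\<in>S - {j}. w T k (P k))" for T
  proof -
    define w' where "w' k = (if k \<in> S - {j} then w T k else (\<lambda>_. 1))" for k
    have w': "(\<Prod>k\<in>S - {j}. w T k (P k)) = (\<Prod>k<m. w' k (P k))" for P
      using S_subset by (intro prod.mono_neutral_cong_left) (auto simp: w'_def m_def)
    have integrable_w': "integrable (\<Gamma>' k) (w' k)" for k
    proof -
      interpret K: prob_space "\<Gamma>' k" by (rule \<Gamma>')
      show ?thesis using integrable_w[of k T] by (auto simp: w'_def)
    qed
    show "integrable X (\<lambda>P. \<Prod>k\<in>S - {j}. w T k (P k))"
      unfolding w' X_def by (intro \<Gamma>'.product_integrable_prod integrable_w') auto
    have "(\<integral>P. (\<Prod>k\<in>S - {j}. w T k (P k)) \<partial>X) = (\<Prod>k<m. integral\<^sup>L (\<Gamma>' k) (w' k))"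
      unfolding w' X_def by (intro \<Gamma>'.product_integral_prod integrable_w') auto
    also have "\<dots> = (\<Prod>k\<in>S - {j}. 1 - \<pi> * measure N {x. x < p \<or> x = p \<and> k \<in> T})"
    proof (rule prod.mono_neutral_cong_right)
      show "\<forall>k\<in>{..<m} - (S - {j}). integral\<^sup>L (\<Gamma>' k) (w' k) = 1"
        using prob_space.prob_space[OF \<Gamma>'(1)] by (auto simp: w'_def)
    qed (use S_subset int_w in \<open>auto simp: m_def w'_def\<close>)
    finally show "(\<integral>P. (\<Prod>k\<in>S - {j}. w T k (P k)) \<partial>X) =
      (\<Prod>k\<in>S - {j}. 1 - \<pi> * measure N {x. x < p \<or> x = p \<and> k \<in> T})" .
  qed
  have inner: "(\<integral>P. f v P \<partial>X) = \<pi> * win_prob N j p * indicator {v. p < v * Q - cost M / \<pi>} v"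
    if v: "0 \<le> v" "v \<le> vbar M" for v
  proof -
    define x where "x = v * Q - cost M / \<pi>"
    define g where "g P = (if p < x then \<pi> * (\<integral>\<tau>. (\<Prod>k\<in>S - {j}. w (t \<tau>) k (P k))
       \<partial>measure_pmf (tie M)) else 0)" for P
    have f_g: "AE P in X. f v P = g P"
      using AE_own AE_lost
    proof eventually_elim
      fix P assume P: "P j = p" "\<forall>k\<in>{..<m} - S. 0 \<le> P k"
      \<comment> \<open>As \<open>qual_mean\<close> is nonnegative, the index of a lost business is
        largest at value \<open>vbar M\<close> and price 0, which is exactly where
        \<open>lost_belief\<close> bounds it.\<close>
      have "\<sigma> v P k \<le> 0" if "k < m" "k \<notin> S" for k
      proof -
        have "v * qual_mean (B k) \<le> vbar M * qual_mean (B k)"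
          using lost[of k] that v by (intro mult_right_mono) (auto simp: m_def)
        moreover have "0 \<le> P k" using P(2) that by simp
        ultimately show ?thesis
          using lost[of k] that
          by (auto simp: \<sigma>_def search_index_def lost_belief_def m_def)
      qed
      moreover have "\<sigma> v P k = x - P k" if "k \<in> S" for k
        using learned[OF that] by (simp add: \<sigma>_def search_index_def x_def)
      ultimately show "f v P = g P"
        unfolding f_def g_def m_def
        by (subst prob_transacts[where P = P and x = x])
           (use \<open>j \<in> S\<close> P(1) in \<open>auto simp: w_def t_def intro!: Bochner_Integration.integral_cong prod.cong\<close>)
    qed
    have "(\<integral>P. f v P \<partial>X) = (\<integral>P. g P \<partial>X)"
      using meas_f1
    proof (rule integral_cong_AE)
      show "AE P in X. f v P = g P" by (rule f_g)
      have "(\<lambda>P. \<integral>\<tau>. (\<Prod>k\<in>S - {j}. w (t \<tau>) k (P k)) \<partial>measure_pmf (tie M)) \<in> borel_measurable X"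
        using finite_S integrable_prod
        by (intro borel_measurable_integrable
              integral_swap_pmf_finite(1)[where A = "Pow S" and g = "\<lambda>T P. \<Prod>k\<in>S - {j}. w T k (P k)"])
           (auto simp: t_def)
      then show "g \<in> borel_measurable X" unfolding g_def by simp
    qed
    also have "\<dots> = (if p < x then \<pi> * (\<integral>P. (\<integral>\<tau>. (\<Prod>k\<in>S - {j}. w (t \<tau>) k (P k)) \<partial>measure_pmf (tie M)) \<partial>X) else 0)"
      unfolding g_def by simp
    also have "(\<integral>P. (\<integral>\<tau>. (\<Prod>k\<in>S - {j}. w (t \<tau>) k (P k)) \<partial>measure_pmf (tie M)) \<partial>X) =
        (\<integral>\<tau>. (\<integral>P. (\<Prod>k\<in>S - {j}. w (t \<tau>) k (P k)) \<partial>X) \<partial>measure_pmf (tie M))"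
      using finite_S integrable_prod
      by (intro integral_swap_pmf_finite(2)[where A = "Pow S" and g = "\<lambda>T P. \<Prod>k\<in>S - {j}. w T k (P k)"])
         (auto simp: t_def)
    also have "\<dots> = win_prob N j p"
      unfolding int_prod win_prob_def
      by (intro Bochner_Integration.integral_cong prod.cong) (auto simp: t_def)
    finally show ?thesis by (simp add: x_def)
  qed
  have "revenue M B \<Gamma> j p = p * (\<integral>v. (\<integral>P. f v P \<partial>X) \<partial>valdist M)"
  proof -
    have X_eq: "X = (\<Pi>\<^sub>M k\<in>{..<nbiz M}. (\<Gamma>(j := return borel p)) k)"
      unfolding X_def m_def by (intro PiM_cong) (auto simp: \<Gamma>'_def m_def)
    show ?thesis unfolding X_eq revenue_def f_def \<sigma>_def m_def ..
  qed
  also have "(\<integral>v. (\<integral>P. f v P \<partial>X) \<partial>valdist M) =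
      (\<integral>v. \<pi> * win_prob N j p * indicator {v. p < v * Q - cost M / \<pi>} v \<partial>valdist M)"
    using meas_int
  proof (rule integral_cong_AE)
    show "AE v in valdist M. (\<integral>P. f v P \<partial>X) =
        \<pi> * win_prob N j p * indicator {v. p < v * Q - cost M / \<pi>} v"
      using AE_valdist by eventually_elim (use inner in auto)
  qed measurable
  also have "\<dots> = \<pi> * win_prob N j p * measure (valdist M) {v. p < v * Q - cost M / \<pi>}"
    by (subst integral_mult_right_zero) simp
  finally show ?thesis by (simp add: R_def sale_def)
qed

end

subsection \<open>Best replies have no atoms\<close>

text \<open>The witness is the leftmost point \<open>q\<close> of the level set of \<open>p\<close>;
  right continuity puts it into the level set. Since the cdf is strictly smaller to the left of
  \<open>q\<close>, every neighbourhood of \<open>q\<close> has positive mass.\<close>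

lemma (in real_distribution) ex_support_point_same_cdf:
  assumes "0 < cdf M p"
  shows "\<exists>q\<in>msupport M. q \<le> p \<and> cdf M q = cdf M p"
proof -
  define A where "A = {x. cdf M x = cdf M p}"
  have "\<forall>\<^sub>F x in at_bot. cdf M x < cdf M p"
    by (rule order_tendstoD(2)[OF cdf_lim_at_bot assms])
  then obtain z where z: "\<And>x. x \<le> z \<Longrightarrow> cdf M x < cdf M p"
    unfolding eventually_at_bot_linorder by blast
  have bdd: "bdd_below A"
  proof (rule bdd_belowI)
    fix x assume "x \<in> A"
    then show "z \<le> x" using z[of x] by (cases "x \<le> z") (auto simp: A_def)
  qed
  define q where "q = Inf A"
  have "p \<in> A" by (simp add: A_def)
  then have "q \<le> p" unfolding q_def using bdd by (rule cInf_lower)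
  have below: "cdf M x < cdf M p" if "x < q" for x
  proof -
    have "x \<notin> A" using that cInf_lower[OF _ bdd, of x] by (auto simp: q_def)
    then show ?thesis using cdf_nondecreasing[of x p] that \<open>q \<le> p\<close> by (auto simp: A_def)
  qed
  have above: "cdf M x = cdf M p" if x: "q < x" "x \<le> p" for x
  proof -
    have "\<exists>y\<in>A. y < x"
      using x(1) \<open>p \<in> A\<close> by (subst cInf_less_iff[OF _ bdd, symmetric]) (auto simp: q_def)
    then obtain y where "y \<in> A" "y < x" ..
    then show ?thesis
      using cdf_nondecreasing[of y x] cdf_nondecreasing[of x p] x by (simp add: A_def)
  qed
  have cdf_q: "cdf M q = cdf M p"
  proof (cases "q = p")
    case False
    with \<open>q \<le> p\<close> have "\<forall>\<^sub>F x in at_right q. cdf M x = cdf M p"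
      by (intro eventually_at_rightI[of q p] above) simp_all
    then have lim_p: "(cdf M \<longlongrightarrow> cdf M p) (at_right q)"
      by (rule tendsto_eventually)
    have lim_q: "(cdf M \<longlongrightarrow> cdf M q) (at_right q)"
      using cdf_is_right_cont[of q] by (simp only: continuous_within)
    show ?thesis by (rule tendsto_unique[OF _ lim_q lim_p]) simp
  qed simp
  have "q \<in> msupport M"
    unfolding msupport_def
  proof (intro CollectI allI impI)
    fix U assume U: "open U" "q \<in> U"
    then obtain e where e: "0 < e" "\<And>y. dist y q < e \<Longrightarrow> y \<in> U"
      unfolding open_dist by metis
    have "{q - e / 2<..q} \<subseteq> U"
    proof
      fix y assume "y \<in> {q - e / 2<..q}"
      then show "y \<in> U" using e(1) by (intro e(2)) (auto simp: dist_real_def)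
    qed
    moreover have "U \<in> sets M" using U by simp
    ultimately have "measure M {q - e / 2<..q} \<le> measure M U"
      by (intro finite_measure_mono) auto
    moreover have "0 < measure M {q - e / 2<..q}"
      using below[of "q - e / 2"] cdf_diff_eq[of "q - e / 2" q] e(1) cdf_q by simp
    ultimately show "0 < measure M U" by simp
  qed
  then show ?thesis using \<open>q \<le> p\<close> cdf_q by blast
qed

lemma msupport_subset_closed:
  assumes "prob_space N" "sets N = sets borel" "closed A" "measure N A = 1"
  shows "msupport N \<subseteq> A"
proof
  interpret prob_space N by fact
  have "A \<in> sets N" using assms by simp
  then have "measure N (- A) = 0"
    using prob_compl[of A] assms sets_eq_imp_space_eq[OF assms(2)] by (simp add: Compl_eq_Diff_UNIV)
  fix p assume "p \<in> msupport N"
  then show "p \<in> A"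
    using \<open>closed A\<close> \<open>measure N (- A) = 0\<close> unfolding msupport_def by (force simp: open_Compl)
qed

text \<open>The formula fixes the cdf on the interval, and full mass there fixes it outside. The
  interval itself is common to both laws because a largest zero is unique.\<close>

lemma has_eq_price_law_unique:
  assumes "real_distribution N" "real_distribution N'"
    and "has_eq_price_law M \<pi> Q n pstar N" "has_eq_price_law M \<pi> Q n pstar N'"
  shows "N = N'"
proof (cases "n = 1")
  case True
  then show ?thesis using assms by (simp add: has_eq_price_law_def)
next
  case False
  obtain plow where plow: "is_lower_price M \<pi> Q n pstar plow"
    and N: "measure N {plow..pstar} = 1" "\<And>p. p \<in> {plow..pstar} \<Longrightarrow> cdf N p = eq_cdf M \<pi> Q n pstar p"
    using assms(3) False by (auto simp: has_eq_price_law_def)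
  obtain plow' where plow': "is_lower_price M \<pi> Q n pstar plow'"
    and N': "measure N' {plow'..pstar} = 1" "\<And>p. p \<in> {plow'..pstar} \<Longrightarrow> cdf N' p = eq_cdf M \<pi> Q n pstar p"
    using assms(4) False by (auto simp: has_eq_price_law_def)
  have "plow' = plow"
    using plow plow' by (auto simp: is_lower_price_def intro!: antisym)
  have outside: "cdf L p = (if p < plow then 0 else 1)"
    if "real_distribution L" "measure L {plow..pstar} = 1" "p \<notin> {plow..pstar}" for L p
  proof -
    interpret real_distribution L by fact
    have "measure L {..p} + 1 \<le> 1" if "p < plow"
    proof -
      have "measure L ({..p} \<union> {plow..pstar}) = measure L {..p} + 1"
        using that \<open>measure L {plow..pstar} = 1\<close> by (subst finite_measure_Union) auto
      then show ?thesis by (metis prob_le_1)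
    qed
    moreover have "measure L {plow..pstar} \<le> measure L {..p}" if "pstar < p"
      using that by (intro finite_measure_mono) auto
    ultimately show ?thesis
      using that prob_le_1[of "{..p}"] measure_nonneg[of L "{..p}"]
      by (cases "p < plow") (auto simp: cdf_def not_less not_le intro!: antisym)
  qed
  have "cdf N p = cdf N' p" for p
    using N N' outside[OF assms(1), of p] outside[OF assms(2), of p] \<open>plow' = plow\<close>
    by (cases "p \<in> {plow..pstar}") auto
  then show ?thesis using assms(1,2) by (intro cdf_unique) auto
qed

section \<open>Winning probabilities\<close>

context learned_type
begin

abbreviation n :: nat where
  "n \<equiv> card S"

lemma card_rivals: "j \<in> S \<Longrightarrow> card (S - {j}) = n - 1"
  using finite_S by simp

text \<open>Ties at \<open>p\<close> have probability 0, so the ranking drops out.\<close>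

lemma win_prob_atomless:
  assumes "real_distribution N" "measure N {p} = 0" "j \<in> S"
  shows "win_prob N j p = (1 - \<pi> * cdf N p) ^ (n - 1)"
proof -
  interpret N: real_distribution N by fact
  have "measure N {x. x < p \<or> x = p \<and> b} = cdf N p" for b
  proof (cases b)
    case True
    then have "{x. x < p \<or> x = p \<and> b} = {..p}" by auto
    then show ?thesis by (simp add: cdf_def)
  next
    case False
    then have "{x. x < p \<or> x = p \<and> b} = {..<p}" by auto
    moreover have "measure N ({..<p} \<union> {p}) = measure N {..<p} + measure N {p}"
      by (intro N.finite_measure_Union) auto
    moreover have "{..<p} \<union> {p} = {..p}" by auto
    ultimately show ?thesis using assms(2) by (simp add: cdf_def)
  qed
  then show ?thesis using card_rivals[OF assms(3)] by (simp add: win_prob_def)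
qed

lemma factor_bounds:
  assumes "real_distribution N"
  shows "0 \<le> 1 - \<pi> * measure N A" "1 - \<pi> * measure N A \<le> 1"
proof -
  interpret N: real_distribution N by fact
  have "\<pi> * measure N A \<le> 1 * 1" using \<pi>_bounds by (intro mult_mono) auto
  then show "0 \<le> 1 - \<pi> * measure N A" by simp
  show "1 - \<pi> * measure N A \<le> 1" using \<pi>_bounds by simp
qed

lemma integrable_prod_factor:
  assumes "real_distribution N"
  shows "integrable (measure_pmf q) (\<lambda>\<tau>. \<Prod>k\<in>S - {j}. 1 - \<pi> * measure N (A k \<tau>))"
proof (rule measure_pmf.integrable_const_bound[of _ 1])
  show "AE \<tau> in measure_pmf q. norm (\<Prod>k\<in>S - {j}. 1 - \<pi> * measure N (A k \<tau>)) \<le> 1"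
    using factor_bounds[OF assms] by (auto simp: abs_prod intro!: prod_le_1)
qed simp

text \<open>The worst case, in which every tie is lost. It holds for laws with atoms too, which
  makes it the right bound for an undercutting price.\<close>

lemma win_prob_ge:
  assumes "real_distribution N" "j \<in> S"
  shows "(1 - \<pi> * cdf N p) ^ (n - 1) \<le> win_prob N j p"
proof -
  interpret N: real_distribution N by fact
  have "(1 - \<pi> * cdf N p) ^ (n - 1) = (\<integral>\<tau>. (\<Prod>k\<in>S - {j}. 1 - \<pi> * cdf N p) \<partial>measure_pmf (tie M))"
    using card_rivals[OF assms(2)] by simp
  also have "\<dots> \<le> win_prob N j p"
    unfolding win_prob_def
  proof (rule integral_mono)
    fix \<tau>
    have "measure N {x. x < p \<or> x = p \<and> \<tau> k < \<tau> j} \<le> cdf N p" for k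
      unfolding cdf_def by (intro N.finite_measure_mono) auto
    then show "(\<Prod>k\<in>S - {j}. 1 - \<pi> * cdf N p)
        \<le> (\<Prod>k\<in>S - {j}. 1 - \<pi> * measure N {x. x < p \<or> x = p \<and> \<tau> k < \<tau> j})"
      using factor_bounds[OF assms(1), of "{..p}"] \<pi>_bounds
      by (intro prod_mono) (auto simp: cdf_def)
  qed (auto intro: integrable_prod_factor assms)
  finally show ?thesis .
qed

lemma win_prob_ge': "real_distribution N \<Longrightarrow> j \<in> S \<Longrightarrow> (1 - \<pi>) ^ (n - 1) \<le> win_prob N j p"
  using win_prob_ge[of N j p] real_distribution.cdf_bounded_prob[of N p] \<pi>_bounds
    power_mono[of "1 - \<pi>" "1 - \<pi> * cdf N p" "n - 1"] mult_left_le[of "cdf N p" \<pi>]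
  by simp

lemma win_prob_le_1:
  assumes "real_distribution N"
  shows "win_prob N j p \<le> 1"
proof -
  have "win_prob N j p \<le> (\<integral>\<tau>. 1 \<partial>measure_pmf (tie M))"
    unfolding win_prob_def using factor_bounds[OF assms]
    by (intro integral_mono integrable_prod_factor assms prod_le_1) auto
  then show ?thesis by simp
qed

text \<open>The right-hand side is what \<open>j\<close> would have if no tie at \<open>p\<close>
  were lost. Whenever \<open>k\<close> is ranked ahead, one factor drops from \<open>a\<close> to
  the strictly smaller \<open>b\<close>, and this has positive probability.\<close>

lemma win_prob_atom_less:
  assumes "real_distribution N" "0 < measure N {p}" "j \<in> S" "k \<in> S - {j}"
    and tie_pos: "0 < measure_pmf.prob (tie M) {\<tau>. \<tau> k < \<tau> j}"
  shows "win_prob N j p < (1 - \<pi> * measure N {..<p}) ^ (n - 1)"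
proof -
  interpret N: real_distribution N by fact
  define a where "a = 1 - \<pi> * measure N {..<p}"
  define b where "b = 1 - \<pi> * measure N {..p}"
  have "measure N ({..<p} \<union> {p}) = measure N {..<p} + measure N {p}"
    by (intro N.finite_measure_Union) auto
  moreover have "{..<p} \<union> {p} = {..p}" by auto
  ultimately have "b < a"
    using assms(2) \<pi>_bounds by (simp add: a_def b_def)
  have "0 \<le> b" using factor_bounds[OF assms(1)] by (simp add: b_def)
  have n: "card (S - {j}) = n - 1" "card (S - {j} - {k}) = n - 2"
    using finite_S assms(3,4) by (auto simp: card_Diff_subset)
  have "n - 1 = Suc (n - 2)"
    using n assms(4) finite_S by (metis card_Suc_Diff1 finite_Diff)
  have factor: "1 - \<pi> * measure N {x. x < p \<or> x = p \<and> c} = (if c then b else a)" for c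
  proof -
    have "{x. x < p \<or> x = p \<and> c} = (if c then {..p} else {..<p})" by auto
    then show ?thesis by (simp add: a_def b_def)
  qed
  \<comment> \<open>Only the factor of rival \<open>k\<close> is kept exactly; the other factors are
    bounded by \<open>a\<close>.\<close>
  have "win_prob N j p \<le> (\<integral>\<tau>. a ^ (n - 1) - (a - b) * a ^ (n - 2) * indicator {\<tau>. \<tau> k < \<tau> j} \<tau>
      \<partial>measure_pmf (tie M))"
    unfolding win_prob_def
  proof (intro integral_mono integrable_prod_factor assms(1))
    fix \<tau>
    have "(\<Prod>i\<in>S - {j}. 1 - \<pi> * measure N {x. x < p \<or> x = p \<and> \<tau> i < \<tau> j}) =
        (if \<tau> k < \<tau> j then b else a) * (\<Prod>i\<in>S - {j} - {k}. if \<tau> i < \<tau> j then b else a)"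
      unfolding factor using finite_S assms(4) by (subst prod.remove[of _ k]) auto
    also have "\<dots> \<le> (if \<tau> k < \<tau> j then b else a) * (\<Prod>i\<in>S - {j} - {k}. a)"
      using \<open>b < a\<close> \<open>0 \<le> b\<close> by (intro mult_left_mono prod_mono) auto
    also have "\<dots> = a ^ (n - 1) - (a - b) * a ^ (n - 2) * indicator {\<tau>. \<tau> k < \<tau> j} \<tau>"
      using n \<open>n - 1 = Suc (n - 2)\<close> by (simp add: algebra_simps)
    finally show "(\<Prod>i\<in>S - {j}. 1 - \<pi> * measure N {x. x < p \<or> x = p \<and> \<tau> i < \<tau> j}) \<le>
        a ^ (n - 1) - (a - b) * a ^ (n - 2) * indicator {\<tau>. \<tau> k < \<tau> j} \<tau>" .
  qed (simp add: measure_pmf.emeasure_eq_measure)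
  also have "\<dots> = a ^ (n - 1) - (a - b) * a ^ (n - 2) * measure_pmf.prob (tie M) {\<tau>. \<tau> k < \<tau> j}"
    by (simp add: measure_pmf.emeasure_eq_measure)
  also have "\<dots> < a ^ (n - 1)"
    using \<open>b < a\<close> \<open>0 \<le> b\<close> tie_pos by simp
  finally show ?thesis by (simp add: a_def)
qed

section \<open>Laws that are best replies to themselves\<close>

text \<open>The equilibrium condition for a common price law, free of beliefs. It quantifies over
  all \<open>j\<close> because the ranking may favour some businesses over others.\<close>

definition best_reply :: "real measure \<Rightarrow> bool" where
  "best_reply N \<longleftrightarrow> real_distribution N \<and>
     (\<forall>j\<in>S. \<forall>p\<in>msupport N. \<forall>p'\<ge>0. R p' * win_prob N j p' \<le> R p * win_prob N j p)"

lemma best_replyD: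
  "best_reply N \<Longrightarrow> p \<in> msupport N \<Longrightarrow> j \<in> S \<Longrightarrow> 0 \<le> p' \<Longrightarrow>
    R p' * win_prob N j p' \<le> R p * win_prob N j p"
  by (simp add: best_reply_def)

lemma R_nonneg: "0 \<le> p \<Longrightarrow> 0 \<le> R p"
  using sale_nonneg by (simp add: R_def)

text \<open>A monopoly price earns at least \<open>(1 - \<pi>) ^ (n - 1) * opt\<close>, even if all
  rivals are ahead. A support point must match this positive amount, which forces
  \<open>0 < R q\<close> and so confines \<open>q\<close>.\<close>

lemma best_reply_support:
  assumes "best_reply N" "q \<in> msupport N" "j \<in> S"
  shows "(1 - \<pi>) ^ (n - 1) * opt \<le> R q * win_prob N j q" "0 < q" "q < vbar M" "0 < R q"
proof -
  have N: "real_distribution N" using assms(1) by (simp add: best_reply_def)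
  obtain pstar where ps: "monopoly_price M \<pi> Q pstar" using ex_monopoly_price by blast
  have "(1 - \<pi>) ^ (n - 1) * opt \<le> R pstar * win_prob N j pstar"
    using win_prob_ge'[OF N assms(3), of pstar] ps opt_pos
    by (simp add: monopoly_price_iff mult.commute)
  also have "\<dots> \<le> R q * win_prob N j q"
  proof -
    have "0 \<le> pstar" using ps by (simp add: monopoly_price_iff)
    then show ?thesis by (rule best_replyD[OF assms])
  qed
  finally show "(1 - \<pi>) ^ (n - 1) * opt \<le> R q * win_prob N j q" .
  moreover have "0 < (1 - \<pi>) ^ (n - 1)" using \<pi>_bounds by simp
  moreover from this have "0 < win_prob N j q" using win_prob_ge'[OF N assms(3), of q] by linarith
  moreover have "0 < (1 - \<pi>) ^ (n - 1) * opt" using \<pi>_bounds opt_pos by simp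
  ultimately show "0 < R q"
    by (meson less_le_trans zero_less_mult_pos2)
  then show "0 < q"
    using mult_nonpos_nonneg[of q "sale q"] sale_nonneg[of q] by (cases "q \<le> 0") (auto simp: R_def)
  show "q < vbar M"
    using sale_zero[of q] \<open>0 < R q\<close> by (cases "vbar M \<le> q") (auto simp: R_def)
qed

lemma tie_inj: "\<tau> \<in> set_pmf (tie M) \<Longrightarrow> inj_on \<tau> S"
proof -
  assume "\<tau> \<in> set_pmf (tie M)"
  moreover have "\<forall>\<tau>\<in>set_pmf (tie M). inj_on \<tau> {..<nbiz M}"
    using market unfolding is_market_def by (elim conjE)
  ultimately show ?thesis using S_subset inj_on_subset by blast
qed

text \<open>
  If rivals charge \<open>p\<close> with positive probability, some business ranked behind one of them with
  positive probability gains a discrete amount of sales by undercutting \<open>p\<close> slightly.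
\<close>

lemma best_reply_atomless:
  assumes N: "best_reply N" and n: "2 \<le> n"
  shows "measure N {p} = 0"
proof (rule ccontr)
  assume "measure N {p} \<noteq> 0"
  then have atom: "0 < measure N {p}" using measure_nonneg[of N "{p}"] by linarith
  have rd: "real_distribution N" using N by (simp add: best_reply_def)
  interpret N: real_distribution N by fact
  have supp: "p \<in> msupport N"
    unfolding msupport_def
  proof (intro CollectI allI impI)
    fix U assume "open U" "p \<in> U"
    then have "measure N {p} \<le> measure N U" by (intro N.finite_measure_mono) auto
    then show "0 < measure N U" using atom by simp
  qed
  obtain j0 k0 where jk0: "j0 \<in> S" "k0 \<in> S" "j0 \<noteq> k0"
  proof -
    have "\<not> n \<le> Suc 0" using n by simp
    then show ?thesis using that by (auto simp: card_le_Suc0_iff_eq finite_S)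
  qed
  \<comment> \<open>Any ranking of positive mass is injective on \<open>S\<close>, so it orders
    \<open>j0\<close> and \<open>k0\<close> strictly; \<open>j\<close> is the one placed
    behind.\<close>
  have "\<exists>j k. j \<in> S \<and> k \<in> S - {j} \<and> 0 < measure_pmf.prob (tie M) {\<tau>. \<tau> k < \<tau> j}"
  proof -
    obtain \<tau> where \<tau>: "\<tau> \<in> set_pmf (tie M)" using set_pmf_not_empty[of "tie M"] by blast
    then have "\<tau> j0 \<noteq> \<tau> k0" using tie_inj[OF \<tau>] jk0 by (auto dest: inj_onD)
    then obtain j k where "j \<in> S" "k \<in> S - {j}" "\<tau> k < \<tau> j"
      using jk0 by (cases "\<tau> j0 < \<tau> k0") (auto dest: antisym_conv3)
    moreover from this have "0 < measure_pmf.prob (tie M) {\<tau>. \<tau> k < \<tau> j}"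
      using \<tau> by (intro measure_pmf_posI) auto
    ultimately show ?thesis by blast
  qed
  then obtain j k where jk: "j \<in> S" "k \<in> S - {j}" "0 < measure_pmf.prob (tie M) {\<tau>. \<tau> k < \<tau> j}"
    by blast
  define A where "A = (1 - \<pi> * measure N {..<p}) ^ (n - 1)"
  have less: "R p * win_prob N j p < R p * A"
    using win_prob_atom_less[OF rd atom jk] best_reply_support(4)[OF N supp jk(1)]
    by (simp add: A_def)
  \<comment> \<open>At any \<open>q < p\<close> the winning probability is at least
    \<open>A\<close>, because \<open>cdf N q\<close> omits the atom at \<open>p\<close>. By
    continuity of \<open>R\<close>, undercutting slightly earns at least nearly
    \<open>R p * A\<close>.\<close>
  have "((\<lambda>q. R q * A) \<longlongrightarrow> R p * A) (at_left p)"
    using isCont_R[of p] by (intro tendsto_intros) (simp add: isCont_def filterlim_at_split)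
  then have "\<forall>\<^sub>F q in at_left p. R p * win_prob N j p < R q * A"
    using less by (rule order_tendstoD)
  moreover have "\<forall>\<^sub>F q in at_left p. q \<in> {0<..<p}"
    using best_reply_support(2)[OF N supp jk(1)] by (rule eventually_at_left_real)
  ultimately have "\<forall>\<^sub>F q in at_left p. False"
  proof eventually_elim
    fix q assume q: "R p * win_prob N j p < R q * A" "q \<in> {0<..<p}"
    have "cdf N q \<le> measure N {..<p}"
      unfolding cdf_def using q(2) by (intro N.finite_measure_mono) auto
    then have "A \<le> (1 - \<pi> * cdf N q) ^ (n - 1)"
      unfolding A_def using \<pi>_bounds factor_bounds[OF rd] by (intro power_mono) auto
    also have "\<dots> \<le> win_prob N j q" by (rule win_prob_ge[OF rd jk(1)])
    finally have "R q * A \<le> R q * win_prob N j q"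
      using q(2) R_nonneg[of q] by (intro mult_left_mono) auto
    also have "\<dots> \<le> R p * win_prob N j p"
      using N supp jk(1) q(2) by (auto simp: best_reply_def)
    finally show False using q(1) by simp
  qed
  then show False by simp
qed

end

subsection \<open>The equilibrium price law\<close>

lemma measure_Icc_eq_1_if_cdf:
  assumes "real_distribution N" "cdf N a = 0" "cdf N b = 1" "a \<le> b"
  shows "measure N {a..b} = 1"
proof -
  interpret real_distribution N by fact
  have "a < b" using assms by (cases "a = b") auto
  then have "measure N {a<..b} = 1"
    using cdf_diff_eq[of a b] assms by simp
  moreover have "measure N {a<..b} \<le> measure N {a..b}"
    by (intro finite_measure_mono) auto
  ultimately show ?thesis using prob_le_1[of "{a..b}"] by linarith
qed

text \<open>A positive cdf value is attained at a support point, so the cdf can only jump at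
  \<open>x\<close>.\<close>

lemma return_if_support_singleton:
  assumes "real_distribution N" "msupport N \<subseteq> {x}"
  shows "N = return borel x"
proof -
  interpret N: real_distribution N by fact
  have cdf_N: "cdf N p = (if p < x then 0 else cdf N x)" for p
  proof (cases "0 < cdf N p")
    case True
    then obtain q where "q \<in> msupport N" "q \<le> p" "cdf N q = cdf N p"
      using N.ex_support_point_same_cdf by blast
    then show ?thesis using assms(2) by auto
  next
    case False
    then have "cdf N p = 0" using N.cdf_nonneg[of p] by simp
    then show ?thesis using N.cdf_nondecreasing[of x p] N.cdf_nonneg[of x] by auto
  qed
  have "\<forall>\<^sub>F p in at_top. cdf N p = cdf N x"
    using cdf_N by (intro eventually_at_top_linorderI[of x]) (metis not_less)
  then have "(cdf N \<longlongrightarrow> cdf N x) at_top" by (rule tendsto_eventually)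
  then have "cdf N x = 1"
    by (rule tendsto_unique[OF trivial_limit_at_top_linorder _ N.cdf_lim_at_top_prob])
  have R: "real_distribution (return borel x)"
    by (simp add: real_distributionI prob_space_return)
  have "cdf N p = cdf (return borel x) p" for p
    using cdf_N[of p] \<open>cdf N x = 1\<close> by (auto simp: cdf_def measure_return indicator_def)
  then show ?thesis using assms(1) R by (intro cdf_unique) auto
qed

context learned_type
begin

section \<open>Indifference in terms of a single rival\<close>

text \<open>The probability that a given rival does not beat price \<open>p\<close>, that is
  \<open>1 - \<pi> * G p\<close>, as dictated by indifference. Working with it keeps the root in
  \<open>eq_cdf\<close> out of the comparisons, which are made between powers.\<close>

definition rel_loss :: "real \<Rightarrow> real" where
  "rel_loss p = (1 - \<pi>) * (opt / R p) powr (1 / (real n - 1))"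

lemma eq_cdf_eq:
  assumes "monopoly_price M \<pi> Q pstar" "0 \<le> p"
  shows "eq_cdf M \<pi> Q n pstar p = (1 - rel_loss p) / \<pi>"
  using assms(1) unfolding eq_cdf_def rel_loss_def monopoly_price_def R_def demand_eq_sale[OF assms(2)]
  by simp

lemma rel_loss_nonneg: "0 \<le> rel_loss p"
  using \<pi>_bounds by (simp add: rel_loss_def)

lemma rel_loss_power:
  assumes "2 \<le> n" "0 < R p"
  shows "rel_loss p ^ (n - 1) = (1 - \<pi>) ^ (n - 1) * opt / R p"
proof -
  have "0 < opt / R p" using opt_pos assms by simp
  have "((opt / R p) powr (1 / (real n - 1))) ^ (n - 1) =
      ((opt / R p) powr (1 / (real n - 1))) powr real (n - 1)"
    using assms(2) opt_pos by (intro powr_realpow[symmetric]) simp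
  also have "\<dots> = (opt / R p) powr (1 / (real n - 1) * real (n - 1))"
    by (rule powr_powr)
  also have "1 / (real n - 1) * real (n - 1) = 1"
    using assms by (simp add: of_nat_diff)
  finally show ?thesis
    using opt_pos assms(2) by (simp add: rel_loss_def power_mult_distrib)
qed

lemma rel_loss_mono:
  assumes "2 \<le> n" "0 < R q" "R q \<le> R p"
  shows "rel_loss p \<le> rel_loss q"
  unfolding rel_loss_def using assms opt_pos \<pi>_bounds
  by (intro mult_left_mono powr_mono2 divide_left_mono) auto

lemma rel_loss_eq_1_iff:
  assumes "2 \<le> n" "0 \<le> p"
  shows "rel_loss p = 1 \<longleftrightarrow> R p = (1 - \<pi>) ^ (n - 1) * opt"
proof (cases "R p = 0")
  \<comment> \<open>Division by 0 makes \<open>rel_loss p\<close> equal to 0 rather than 1, so a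
    price of zero revenue, such as 0, is never a zero of \<open>eq_cdf\<close>.\<close>
  case True
  then show ?thesis using opt_pos \<pi>_bounds by (simp add: rel_loss_def)
next
  case False
  then have "0 < R p" using R_nonneg[OF assms(2)] by simp
  have "rel_loss p = 1 \<longleftrightarrow> rel_loss p ^ (n - 1) = 1"
    using rel_loss_nonneg[of p] assms(1) power_eq_1_iff[of "rel_loss p" "n - 1"] by auto
  then show ?thesis
    unfolding rel_loss_power[OF assms(1) \<open>0 < R p\<close>] using \<open>0 < R p\<close> by (auto simp: divide_eq_1_iff)
qed

lemma rel_loss_monopoly: "R p = opt \<Longrightarrow> rel_loss p = 1 - \<pi>"
  using opt_pos by (simp add: rel_loss_def)

text \<open>The zeros of \<open>eq_cdf\<close> are the prices with
  \<open>R p = (1 - \<pi>) ^ (n - 1) * opt\<close>. For \<open>2 \<le> n\<close> this level lies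
  strictly between \<open>R 0\<close> and \<open>opt\<close>, so \<open>R\<close> attains it, and
  strict monotonicity below the maximum excludes a larger solution up to
  \<open>pstar\<close>.\<close>

lemma ex_lower_price:
  assumes ps: "monopoly_price M \<pi> Q pstar" and n: "2 \<le> n"
  obtains plow where "is_lower_price M \<pi> Q n pstar plow" "0 < plow" "plow \<le> pstar"
    "R plow = (1 - \<pi>) ^ (n - 1) * opt"
proof -
  define u where "u = (1 - \<pi>) ^ (n - 1) * opt"
  have "(1 - \<pi>) ^ (n - 1) < 1" using n \<pi>_bounds by (subst power_less_one_iff) auto
  then have u: "0 < u" "u < opt" using opt_pos \<pi>_bounds by (simp_all add: u_def)
  have "\<exists>p\<ge>0. p \<le> pstar \<and> R p = u"
    using ps u isCont_R by (intro IVT) (auto simp: monopoly_price_iff R_def[of 0])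
  then obtain plow where plow: "0 \<le> plow" "plow \<le> pstar" "R plow = u" by blast
  then have "0 < plow" using u by (cases "plow = 0") (auto simp: R_def)
  have "p \<le> plow" if p: "0 \<le> p" "p \<le> pstar" "eq_cdf M \<pi> Q n pstar p = 0" for p
  proof (rule ccontr)
    assume "\<not> p \<le> plow"
    moreover have "R p = u"
      using p \<pi>_bounds rel_loss_eq_1_iff[OF n] eq_cdf_eq[OF ps p(1)] by (simp add: u_def)
    ultimately show False
      using R_strict_mono[OF ps plow(1), of p] p plow u by simp
  qed
  moreover have "eq_cdf M \<pi> Q n pstar plow = 0"
    using plow rel_loss_eq_1_iff[OF n] eq_cdf_eq[OF ps plow(1)] by (simp add: u_def)
  ultimately have "is_lower_price M \<pi> Q n pstar plow"
    using plow by (auto simp: is_lower_price_def)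
  then show ?thesis using that \<open>0 < plow\<close> plow u_def by blast
qed

text \<open>
  At a support point \<open>q\<close> the revenue equals \<open>(1 - \<pi>) ^ (n - 1) * opt\<close>, so \<open>cdf N q\<close> is given by
  the formula; elsewhere the formula is a lower bound. As \<open>cdf N\<close> is constant between support
  points while the formula increases up to \<open>pstar\<close>, the two agree wherever the formula is
  nonnegative.
\<close>

lemma best_reply_price_law:
  assumes N: "best_reply N" and n: "2 \<le> n" and ps: "monopoly_price M \<pi> Q pstar"
  shows "has_eq_price_law M \<pi> Q n pstar N"
proof -
  have rd: "real_distribution N" using N by (simp add: best_reply_def)
  interpret N: real_distribution N by fact
  obtain j where "j \<in> S" using S_nonempty by blast
  have win: "win_prob N j p = (1 - \<pi> * cdf N p) ^ (n - 1)" for p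
    by (rule win_prob_atomless[OF rd best_reply_atomless[OF N n] \<open>j \<in> S\<close>])
  define u where "u = (1 - \<pi>) ^ (n - 1) * opt"
  have \<pi>_cdf: "0 \<le> 1 - \<pi> * cdf N p" for p
    using factor_bounds[OF rd] by (simp add: cdf_def)
  \<comment> \<open>Boundedness of the support makes the cdf reach 1 instead of merely approaching
    it. Hence the top is a genuine support point \<open>top\<close>, to which the best-reply
    condition applies.\<close>
  have "cdf N (vbar M) = 1"
  proof (rule antisym)
    have "\<forall>\<^sub>F x in at_top. 0 < cdf N x"
      by (rule order_tendstoD(1)[OF N.cdf_lim_at_top_prob]) simp
    then have "\<forall>\<^sub>F x in at_top. cdf N x \<le> cdf N (vbar M)"
    proof eventually_elim
      fix x assume "0 < cdf N x"
      then obtain q where q: "q \<in> msupport N" "cdf N q = cdf N x"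
        using N.ex_support_point_same_cdf by blast
      then show "cdf N x \<le> cdf N (vbar M)"
        using best_reply_support(3)[OF N q(1) \<open>j \<in> S\<close>] N.cdf_nondecreasing[of q "vbar M"] by simp
    qed
    then show "1 \<le> cdf N (vbar M)"
      by (rule tendsto_upperbound[OF N.cdf_lim_at_top_prob]) simp
  qed (rule N.cdf_bounded_prob)
  then obtain top where top: "top \<in> msupport N" "cdf N top = 1"
    using N.ex_support_point_same_cdf[of "vbar M"] by auto
  have at_support: "R q * (1 - \<pi> * cdf N q) ^ (n - 1) = u" if q: "q \<in> msupport N" for q
  proof (rule antisym)
    have "R q * win_prob N j q \<le> R top * win_prob N j top"
      using best_reply_support(2)[OF N q \<open>j \<in> S\<close>] by (intro best_replyD N top(1) \<open>j \<in> S\<close>) simp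
    also have "\<dots> \<le> u"
      using R_le_opt[of top] best_reply_support(2)[OF N top(1) \<open>j \<in> S\<close>] top(2) \<pi>_bounds
      by (simp add: win u_def mult.commute mult_left_mono)
    finally show "R q * (1 - \<pi> * cdf N q) ^ (n - 1) \<le> u" by (simp add: win)
    show "u \<le> R q * (1 - \<pi> * cdf N q) ^ (n - 1)"
      using best_reply_support(1)[OF N q \<open>j \<in> S\<close>] by (simp add: win u_def)
  qed
  have bound: "R p * (1 - \<pi> * cdf N p) ^ (n - 1) \<le> u" if "0 \<le> p" for p
    using best_replyD[OF N top(1) \<open>j \<in> S\<close> that] at_support[OF top(1)] by (simp add: win)
  have upper: "1 - \<pi> * cdf N p \<le> rel_loss p" if "0 \<le> p" "0 < R p" for p
  proof -
    have "R p * rel_loss p ^ (n - 1) = u"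
      unfolding rel_loss_power[OF n that(2)] u_def using that(2) by simp
    then have "R p * (1 - \<pi> * cdf N p) ^ (n - 1) \<le> R p * rel_loss p ^ (n - 1)"
      using bound[OF that(1)] by simp
    then have "(1 - \<pi> * cdf N p) ^ (n - 1) \<le> rel_loss p ^ (n - 1)"
      using that(2) by (rule mult_left_le_imp_le)
    then show ?thesis
      using power_mono_iff[OF \<pi>_cdf rel_loss_nonneg, of "n - 1"] n by simp
  qed
  obtain plow where plow: "is_lower_price M \<pi> Q n pstar plow" "0 < plow" "plow \<le> pstar"
    "R plow = u" unfolding u_def by (rule ex_lower_price[OF ps n])
  have "0 < u" using \<pi>_bounds opt_pos by (simp add: u_def)
  have R_pos: "0 < R p" if "plow \<le> p" "p \<le> pstar" for p
    using R_mono[OF ps, of plow p] that plow \<open>0 < u\<close> by simp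
  have eq_cdf_nonneg: "rel_loss p \<le> 1" if "plow \<le> p" "p \<le> pstar" for p
    using rel_loss_mono[OF n, of plow p] R_mono[OF ps, of plow p] that plow \<open>0 < u\<close>
      rel_loss_eq_1_iff[OF n, of plow] by (simp add: u_def)
  have cdf_N: "cdf N p = eq_cdf M \<pi> Q n pstar p" if p: "plow \<le> p" "p \<le> pstar" for p
  proof -
    have "1 - \<pi> * cdf N p = rel_loss p"
    proof (rule antisym)
      show "1 - \<pi> * cdf N p \<le> rel_loss p"
        using upper[of p] R_pos[OF p] p plow by simp
      show "rel_loss p \<le> 1 - \<pi> * cdf N p"
      proof (cases "0 < cdf N p")
        case True
        then obtain q where q: "q \<in> msupport N" "q \<le> p" "cdf N q = cdf N p"
          using N.ex_support_point_same_cdf by blast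
        note q_pos = best_reply_support(2,4)[OF N q(1) \<open>j \<in> S\<close>]
        have "rel_loss q ^ (n - 1) = (1 - \<pi> * cdf N q) ^ (n - 1)"
          unfolding rel_loss_power[OF n q_pos(2)] u_def[symmetric]
          using at_support[OF q(1)] q_pos(2) by (simp add: divide_eq_eq mult.commute)
        then have "rel_loss q = 1 - \<pi> * cdf N q"
          by (rule power_eq_imp_eq_base[OF _ rel_loss_nonneg \<pi>_cdf]) (use n in simp)
        then show ?thesis
          using rel_loss_mono[OF n q_pos(2), of p] R_mono[OF ps, of q p] q_pos q p by simp
      next
        case False
        then have "cdf N p = 0" using N.cdf_nonneg[of p] by simp
        then show ?thesis using eq_cdf_nonneg[OF p] by simp
      qed
    qed
    then have "rel_loss p = 1 - \<pi> * cdf N p" by (rule sym)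
    moreover have "0 \<le> p" using p plow by simp
    ultimately show ?thesis
      using \<pi>_bounds by (simp add: eq_cdf_eq[OF ps])
  qed
  have "cdf N plow = 0" "cdf N pstar = 1"
    using cdf_N plow ps eq_cdf_eq[OF ps, of pstar] rel_loss_monopoly[of pstar] \<pi>_bounds
    by (auto simp: is_lower_price_def monopoly_price_iff)
  then have "measure N {plow..pstar} = 1"
    using plow by (intro measure_Icc_eq_1_if_cdf rd)
  then show ?thesis
    using plow(1) cdf_N n by (auto simp: has_eq_price_law_def)
qed

section \<open>The price law is a best reply and exists\<close>

text \<open>The converse of the indifference argument. Below \<open>plow\<close> even a sure win
  earns at most \<open>R plow\<close>; beyond \<open>pstar\<close> all rivals are cheaper and
  \<open>R\<close> is at most \<open>opt\<close>; in between the formula equalizes revenue.\<close>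

lemma price_law_revenue:
  assumes rd: "real_distribution N" and atomless: "\<And>p. measure N {p} = 0" and n: "2 \<le> n"
    and ps: "monopoly_price M \<pi> Q pstar" and law: "has_eq_price_law M \<pi> Q n pstar N"
    and j: "j \<in> S"
  shows "0 \<le> p \<Longrightarrow> R p * win_prob N j p \<le> (1 - \<pi>) ^ (n - 1) * opt"
    and "AE p in N. R p * win_prob N j p = (1 - \<pi>) ^ (n - 1) * opt"
    and "p \<in> msupport N \<Longrightarrow> R p * win_prob N j p = (1 - \<pi>) ^ (n - 1) * opt"
    and "AE p in N. 0 \<le> p"
proof -
  interpret N: real_distribution N by fact
  define u where "u = (1 - \<pi>) ^ (n - 1) * opt"
  have "0 < u" using \<pi>_bounds opt_pos by (simp add: u_def)
  obtain plow where plow: "is_lower_price M \<pi> Q n pstar plow"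
    and mass: "measure N {plow..pstar} = 1"
    and cdf_N: "\<And>p. plow \<le> p \<Longrightarrow> p \<le> pstar \<Longrightarrow> cdf N p = eq_cdf M \<pi> Q n pstar p"
    using law n by (auto simp: has_eq_price_law_def)
  then have plow_bounds: "0 \<le> plow" "plow \<le> pstar" and "eq_cdf M \<pi> Q n pstar plow = 0"
    by (auto simp: is_lower_price_def)
  then have R_plow: "R plow = u"
    using rel_loss_eq_1_iff[OF n, of plow] eq_cdf_eq[OF ps, of plow] \<pi>_bounds by (simp add: u_def)
  have win: "win_prob N j p = (1 - \<pi> * cdf N p) ^ (n - 1)" for p
    by (rule win_prob_atomless[OF rd atomless j])
  have inside: "R p * win_prob N j p = u" if "plow \<le> p" "p \<le> pstar" for p
  proof -
    have "0 < R p"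
      using R_mono[OF ps plow_bounds(1) that] R_plow \<open>0 < u\<close> by simp
    have "1 - \<pi> * cdf N p = rel_loss p"
      using cdf_N[OF that] eq_cdf_eq[OF ps, of p] plow_bounds that \<pi>_bounds by simp
    then show ?thesis
      using rel_loss_power[OF n \<open>0 < R p\<close>] \<open>0 < R p\<close> by (simp add: win u_def)
  qed
  have AE_range: "AE p in N. p \<in> {plow..pstar}"
    using mass by (subst N.AE_in_set_eq_1) auto
  then show "AE p in N. R p * win_prob N j p = (1 - \<pi>) ^ (n - 1) * opt"
    by eventually_elim (use inside in \<open>auto simp: u_def\<close>)
  from AE_range show "AE p in N. 0 \<le> p"
    by eventually_elim (use plow_bounds in auto)
  have "msupport N \<subseteq> {plow..pstar}"
    using mass N.prob_space_axioms by (intro msupport_subset_closed) auto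
  then show "R p * win_prob N j p = (1 - \<pi>) ^ (n - 1) * opt" if "p \<in> msupport N"
    using inside[of p] that by (auto simp: u_def)
  show "R p * win_prob N j p \<le> (1 - \<pi>) ^ (n - 1) * opt" if "0 \<le> p"
  proof -
    consider "p < plow" | "plow \<le> p" "p \<le> pstar" | "pstar < p" by linarith
    then have "R p * win_prob N j p \<le> u"
    proof cases
      case 1
      then have "R p \<le> u" using R_mono[OF ps that, of plow] plow_bounds R_plow by simp
      then show ?thesis
        using win_prob_le_1[OF rd, of j p] R_nonneg[OF that] mult_left_le[of "win_prob N j p" "R p"]
        by simp
    next
      case 2
      then show ?thesis using inside by simp
    next
      case 3
      have "cdf N pstar = 1"
        using cdf_N[of pstar] plow_bounds ps eq_cdf_eq[OF ps, of pstar] rel_loss_monopoly[of pstar] \<pi>_bounds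
        by (auto simp: monopoly_price_iff)
      then have "cdf N p = 1"
        using N.cdf_nondecreasing[of pstar p] N.cdf_bounded_prob[of p] 3 by simp
      then show ?thesis
        using R_le_opt[OF that] \<pi>_bounds by (simp add: win u_def mult.commute mult_left_mono)
    qed
    then show ?thesis by (simp add: u_def)
  qed
qed

lemma ex_price_law:
  assumes n: "2 \<le> n" and ps: "monopoly_price M \<pi> Q pstar"
  obtains N where "real_distribution N" "\<And>p. measure N {p} = 0" "has_eq_price_law M \<pi> Q n pstar N"
proof -
  obtain plow where plow: "is_lower_price M \<pi> Q n pstar plow" "0 < plow" "plow \<le> pstar"
    "R plow = (1 - \<pi>) ^ (n - 1) * opt" by (rule ex_lower_price[OF ps n])
  \<comment> \<open>Clamping the argument continues the formula by 0 below \<open>plow\<close> and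
    by 1 above \<open>pstar\<close>. The result is continuous and nondecreasing, and continuity also
    rules out atoms.\<close>
  define cl where "cl p = max plow (min p pstar)" for p
  define G where "G p = (1 - rel_loss (cl p)) / \<pi>" for p
  have cl: "plow \<le> cl p" "cl p \<le> pstar" for p
    using plow by (auto simp: cl_def)
  have "0 < R plow" using plow(4) \<pi>_bounds opt_pos by simp
  have R_pos: "0 < R (cl p)" for p
    using R_mono[OF ps, of plow "cl p"] cl[of p] plow \<open>0 < R plow\<close> by simp
  have G_mono: "G p \<le> G q" if "p \<le> q" for p q
  proof -
    have "cl p \<le> cl q" using that by (auto simp: cl_def)
    then have "rel_loss (cl q) \<le> rel_loss (cl p)"
      using R_mono[OF ps, of "cl p" "cl q"] cl[of p] cl[of q] plow by (intro rel_loss_mono n R_pos) simp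
    then show ?thesis using \<pi>_bounds by (simp add: G_def divide_right_mono)
  qed
  have "isCont cl p" for p
    unfolding cl_def by (intro continuous_intros)
  then have "isCont (\<lambda>p. R (cl p)) p" for p
    using isCont_R by (rule isCont_o2)
  then have G_cont: "isCont G p" for p
    unfolding G_def rel_loss_def using R_pos[of p] opt_pos \<pi>_bounds
    by (intro continuous_intros) auto
  have "G p = 0" if "p \<le> plow" for p
  proof -
    have "cl p = plow" using that plow by (simp add: cl_def)
    then show ?thesis using rel_loss_eq_1_iff[OF n, of plow] plow by (simp add: G_def)
  qed
  then have "\<forall>\<^sub>F p in at_bot. G p = 0"
    unfolding eventually_at_bot_linorder by blast
  then have G_bot: "(G \<longlongrightarrow> 0) at_bot" by (rule tendsto_eventually)
  have "G p = 1" if "pstar \<le> p" for p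
  proof -
    have "cl p = pstar" using that plow by (simp add: cl_def)
    then show ?thesis
      using rel_loss_monopoly[of pstar] ps \<pi>_bounds by (simp add: G_def monopoly_price_iff)
  qed
  then have "\<forall>\<^sub>F p in at_top. G p = 1"
    unfolding eventually_at_top_linorder by blast
  then have G_top: "(G \<longlongrightarrow> 1) at_top" by (rule tendsto_eventually)
  define N where "N = interval_measure G"
  have right_cont: "continuous (at_right p) G" for p
    using G_cont by (rule continuous_at_imp_continuous_within)
  have rd: "real_distribution N"
    unfolding N_def by (intro real_distribution_interval_measure G_mono right_cont G_bot G_top)
  interpret N: real_distribution N by fact
  have cdf_N: "cdf N = G"
    unfolding N_def by (intro cdf_interval_measure G_mono right_cont G_bot)
  have "measure N {p} = 0" for p
    using N.isCont_cdf[of p] G_cont by (simp add: cdf_N)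
  moreover have "cdf N p = eq_cdf M \<pi> Q n pstar p" if "plow \<le> p" "p \<le> pstar" for p
  proof -
    have "cl p = p" using that by (simp add: cl_def)
    then show ?thesis using eq_cdf_eq[OF ps, of p] that plow by (simp add: cdf_N G_def)
  qed
  moreover have "measure N {plow..pstar} = 1"
    using \<open>\<And>p. p \<le> plow \<Longrightarrow> G p = 0\<close> \<open>\<And>p. pstar \<le> p \<Longrightarrow> G p = 1\<close> plow
    by (intro measure_Icc_eq_1_if_cdf rd) (auto simp: cdf_N)
  ultimately have "has_eq_price_law M \<pi> Q n pstar N"
    using plow(1) n by (auto simp: has_eq_price_law_def)
  then show ?thesis
    by (rule that[OF rd \<open>\<And>p. measure N {p} = 0\<close>])
qed

end

subsection \<open>Existence and uniqueness\<close>

lemma measurable_fst_snd_borel [measurable]: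
  "fst \<in> borel_measurable (borel :: (real \<times> real) measure)"
  "snd \<in> borel_measurable (borel :: (real \<times> real) measure)"
  by (intro borel_measurable_continuous_onI continuous_intros)+

lemma fit_mean_return: "fit_mean (return borel (a, b)) = a"
  by (simp add: fit_mean_def integral_return)

lemma qual_mean_return: "qual_mean (return borel (a, b)) = b"
  by (simp add: qual_mean_def integral_return)

lemma qual_mean_nonneg: "AE x in B. 0 \<le> snd x \<Longrightarrow> 0 \<le> qual_mean B"
  unfolding qual_mean_def by (rule integral_nonneg_AE)

lemma AE_return_belief:
  assumes "0 < a" "a < 1" "0 \<le> b" "b \<le> 1"
  shows "AE x in return borel (a, b :: real). 0 < fst x \<and> fst x < (1 :: real) \<and> 0 \<le> snd x \<and> snd x \<le> 1"
  using assms by (subst AE_return) auto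

lemma is_market_params:
  assumes "is_market M"
  shows "j < nbiz M \<Longrightarrow> 0 < fitp M j \<and> fitp M j < 1 \<and> 0 \<le> qual M j \<and> qual M j \<le> 1" and "0 \<le> cost M"
  using assms unfolding is_market_def by (elim conjE; blast)+

lemma market_equilibriumD:
  assumes "market_equilibrium M B \<Gamma>" "j < nbiz M"
  shows "AE x in B j. 0 \<le> snd x" "B j = true_belief M j \<or> lost_belief M (B j)"
    "prob_space (\<Gamma> j)" "sets (\<Gamma> j) = sets borel" "AE p in \<Gamma> j. 0 \<le> p"
    "\<lbrakk>p \<in> msupport (\<Gamma> j); 0 \<le> p'\<rbrakk> \<Longrightarrow> revenue M B \<Gamma> j p' \<le> revenue M B \<Gamma> j p"
proof -
  have "AE x in B j. 0 < fst x \<and> fst x < 1 \<and> 0 \<le> snd x \<and> snd x \<le> 1"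
    using assms unfolding market_equilibrium_def by blast
  then show "AE x in B j. 0 \<le> snd x" by eventually_elim simp
qed (use assms in \<open>unfold market_equilibrium_def, blast\<close>)+

lemma symmetric_equilibriumD:
  assumes "symmetric_equilibrium M S B \<Gamma>"
  shows "market_equilibrium M B \<Gamma>" "j < nbiz M \<Longrightarrow> j \<in> S \<longleftrightarrow> B j = true_belief M j"
    "\<lbrakk>j \<in> S; k \<in> S\<rbrakk> \<Longrightarrow> \<Gamma> j = \<Gamma> k"
  using assms unfolding symmetric_equilibrium_def eq_learned_set_def by blast+

lemma ex_equilibrium_beliefs:
  assumes "is_market M"
  shows "\<exists>B. \<forall>j<nbiz M. prob_space (B j) \<and> sets (B j) = sets borel \<and>
    (AE x in B j. 0 < fst x \<and> fst x < 1 \<and> 0 \<le> snd x \<and> snd x \<le> 1) \<and>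
    (if j \<in> S then B j = true_belief M j else lost_belief M (B j) \<and> B j \<noteq> true_belief M j)"
proof -
  \<comment> \<open>A business outside \<open>S\<close> must not hold its true belief, or
    \<open>eq_learned_set\<close> would contain it. Quality 0 alone does not ensure this, since the
    true quality may be 0, so the believed fit probability is chosen different from the true
    one.\<close>
  define a where "a j = (if fitp M j = 1 / 2 then 1 / 3 else 1 / 2 :: real)" for j
  define B where "B j = (if j \<in> S then true_belief M j else return borel (a j, 0))" for j
  have "prob_space (B j)" "sets (B j) = sets borel" for j
    by (simp_all add: B_def true_belief_def prob_space_return)
  moreover have "AE x in B j. 0 < fst x \<and> fst x < 1 \<and> 0 \<le> snd x \<and> snd x \<le> 1" if "j < nbiz M" for j
  proof (cases "j \<in> S")
    case True
    then have B: "B j = return borel (fitp M j, qual M j)" by (simp add: B_def true_belief_def)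
    show ?thesis
      unfolding B using is_market_params(1)[OF assms that] by (intro AE_return_belief) auto
  next
    case False
    then have B: "B j = return borel (a j, 0)" by (simp add: B_def)
    show ?thesis unfolding B by (intro AE_return_belief) (auto simp: a_def)
  qed
  moreover have "lost_belief M (B j)" if "j \<notin> S" for j
    using that is_market_params(2)[OF assms]
    by (simp add: B_def lost_belief_def fit_mean_return qual_mean_return search_index_def a_def)
  moreover have "B j \<noteq> true_belief M j" if "j \<notin> S" for j
  proof
    assume "B j = true_belief M j"
    then have "fit_mean (B j) = fitp M j" by (simp add: true_belief_def fit_mean_return)
    then show False using that by (simp add: B_def fit_mean_return a_def split: if_splits)
  qed
  ultimately show ?thesis by (intro exI[of _ B]) (auto simp: B_def)
qed

lemma symmetric_equilibrium_constI:
  assumes S: "S \<subseteq> {..<nbiz M}"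
    and B: "\<And>j. j < nbiz M \<Longrightarrow> prob_space (B j) \<and> sets (B j) = sets borel \<and>
      (AE x in B j. 0 < fst x \<and> fst x < 1 \<and> 0 \<le> snd x \<and> snd x \<le> 1) \<and>
      (if j \<in> S then B j = true_belief M j else lost_belief M (B j) \<and> B j \<noteq> true_belief M j)"
    and N: "prob_space N \<and> sets N = sets borel \<and> (AE p in N. 0 \<le> p)"
    and rev: "\<And>j p p'. \<lbrakk>j < nbiz M; p \<in> msupport N; 0 \<le> p'\<rbrakk> \<Longrightarrow>
      revenue M B (\<lambda>_. N) j p' \<le> revenue M B (\<lambda>_. N) j p"
  shows "symmetric_equilibrium M S B (\<lambda>_. N)"
proof -
  have cases: "j \<in> S \<and> B j = true_belief M j \<or>
      j \<notin> S \<and> lost_belief M (B j) \<and> B j \<noteq> true_belief M j" if "j < nbiz M" for j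
    using B[OF that] by (cases "j \<in> S") simp_all
  have "market_equilibrium M B (\<lambda>_. N)"
    unfolding market_equilibrium_def using B cases N rev by blast
  moreover have "eq_learned_set M B = S"
    unfolding eq_learned_set_def using cases S by blast
  ultimately show ?thesis by (simp add: symmetric_equilibrium_def)
qed

text \<open>The equilibrium condition covers lost businesses too. All nonnegative prices earn them
  the same, so they may share the price law of the learned ones.\<close>

lemma revenue_lost:
  assumes "is_market M" "j < nbiz M" "lost_belief M (B j)" "0 \<le> qual_mean (B j)" "0 \<le> p"
    and prob: "\<And>k. k < nbiz M \<Longrightarrow> prob_space (\<Gamma> k)"
  shows "revenue M B \<Gamma> j p = 0"
proof -
  define X where "X = (\<Pi>\<^sub>M k\<in>{..<nbiz M}. (\<Gamma>(j := return borel p)) k)"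
  have "AE P in X. P j = p"
    unfolding X_def
  proof (rule AE_PiM_component)
    show "AE x in (\<Gamma>(j := return borel p)) j. x = p"
      unfolding fun_upd_same by (subst AE_return) auto
  qed (use prob assms(2) prob_space_return[of p borel] in auto)
  have inner: "(\<integral>P. measure_pmf.prob (pair_pmf (fits_pmf M) (tie M)) {(F, \<tau>). transacts (nbiz M)
      (\<lambda>k. search_index (cost M) (P k) (fit_mean (B k)) (qual_mean (B k)) v) \<tau> F j} \<partial>X) = 0"
    if v: "0 \<le> v" "v \<le> vbar M" for v
  proof (rule integral_eq_zero_AE)
    show "AE P in X. measure_pmf.prob (pair_pmf (fits_pmf M) (tie M)) {(F, \<tau>). transacts (nbiz M)
      (\<lambda>k. search_index (cost M) (P k) (fit_mean (B k)) (qual_mean (B k)) v) \<tau> F j} = 0"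
      using \<open>AE P in X. P j = p\<close>
    proof eventually_elim
      fix P assume "P j = p"
      have "v * qual_mean (B j) \<le> vbar M * qual_mean (B j)"
        using v assms(4) by (intro mult_right_mono) auto
      then have "\<not> 0 < search_index (cost M) (P j) (fit_mean (B j)) (qual_mean (B j)) v"
        using assms(3,5) \<open>P j = p\<close> by (simp add: search_index_def lost_belief_def)
      then show "measure_pmf.prob (pair_pmf (fits_pmf M) (tie M)) {(F, \<tau>). transacts (nbiz M)
          (\<lambda>k. search_index (cost M) (P k) (fit_mean (B k)) (qual_mean (B k)) v) \<tau> F j} = 0"
        by (simp add: transacts_iff)
    qed
  qed
  have "AE v in valdist M. 0 \<le> v \<and> v \<le> vbar M"
    using assms(1) unfolding is_market_def by simp
  then have "AE v in valdist M. (\<integral>P. measure_pmf.prob (pair_pmf (fits_pmf M) (tie M))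
      {(F, \<tau>). transacts (nbiz M)
      (\<lambda>k. search_index (cost M) (P k) (fit_mean (B k)) (qual_mean (B k)) v) \<tau> F j} \<partial>X) = 0"
    by eventually_elim (use inner in blast)
  then show ?thesis
    unfolding revenue_def X_def[symmetric] by (simp add: integral_eq_zero_AE)
qed

section \<open>Equilibria with a nonempty learned set\<close>

context learned_type
begin

lemma symmetric_equilibrium_revenue:
  assumes E: "symmetric_equilibrium M S B \<Gamma>" and "j \<in> S" "i \<in> S"
  shows "revenue M B \<Gamma> i p = R p * win_prob (\<Gamma> j) i p"
proof (rule revenue_eq[OF \<open>i \<in> S\<close>])
  note eq = symmetric_equilibriumD(1)[OF E]
  show "fit_mean (B k) = \<pi> \<and> qual_mean (B k) = Q \<and> \<Gamma> k = \<Gamma> j" if k: "k \<in> S" for k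
  proof -
    have "k < nbiz M" using k S_subset by auto
    then have "B k = true_belief M k" using symmetric_equilibriumD(2)[OF E] k by blast
    then have "fit_mean (B k) = \<pi>" "qual_mean (B k) = Q"
      using k by (simp_all add: true_belief_def fit_mean_return qual_mean_return fitp_S qual_S)
    then show ?thesis using symmetric_equilibriumD(3)[OF E k \<open>j \<in> S\<close>] by blast
  qed
  show "lost_belief M (B k) \<and> 0 \<le> qual_mean (B k)" if k: "k < nbiz M" "k \<notin> S" for k
    using market_equilibriumD(2)[OF eq k(1)] symmetric_equilibriumD(2)[OF E k(1)] k(2)
      qual_mean_nonneg[OF market_equilibriumD(1)[OF eq k(1)]] by blast
  show "prob_space (\<Gamma> k) \<and> sets (\<Gamma> k) = sets borel \<and> (AE p in \<Gamma> k. 0 \<le> p)" if "k < nbiz M" for k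
    using market_equilibriumD(3-5)[OF eq that] by blast
qed

lemma symmetric_equilibrium_best_reply:
  assumes E: "symmetric_equilibrium M S B \<Gamma>" and j: "j \<in> S"
  shows "best_reply (\<Gamma> j)"
proof -
  note eq = symmetric_equilibriumD(1)[OF E]
  have "j < nbiz M" using j S_subset by auto
  then have "real_distribution (\<Gamma> j)"
    using market_equilibriumD(3,4)[OF eq] by (intro real_distributionI)
  moreover have "R p' * win_prob (\<Gamma> j) i p' \<le> R p * win_prob (\<Gamma> j) i p"
    if i: "i \<in> S" and p: "p \<in> msupport (\<Gamma> j)" "0 \<le> p'" for i p p'
  proof -
    have "i < nbiz M" using i S_subset by auto
    moreover have "p \<in> msupport (\<Gamma> i)"
      unfolding symmetric_equilibriumD(3)[OF E i j] by (rule p)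
    ultimately have "revenue M B \<Gamma> i p' \<le> revenue M B \<Gamma> i p"
      using p(2) by (rule market_equilibriumD(6)[OF eq])
    then show ?thesis
      unfolding symmetric_equilibrium_revenue[OF E j i] .
  qed
  ultimately show ?thesis by (simp add: best_reply_def)
qed

lemma win_prob_single: "n = 1 \<Longrightarrow> j \<in> S \<Longrightarrow> win_prob N j p = 1"
proof -
  assume "n = 1" "j \<in> S"
  then have "S - {j} = {}" by (metis Diff_cancel card_1_singletonE singletonD)
  show ?thesis unfolding win_prob_def \<open>S - {j} = {}\<close> by simp
qed

lemma borel_measurable_R [measurable]: "R \<in> borel_measurable borel"
  by (intro borel_measurable_continuous_onI continuous_at_imp_continuous_on ballI isCont_R)

text \<open>A single seller always wins, so every support point is a monopoly price, and
  \<open>single\<close> then forces a point mass. With rivals, the indifference condition determines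
  the law and makes revenue constant almost everywhere under it.\<close>

lemma symmetric_equilibrium_expected_revenue:
  assumes E: "symmetric_equilibrium M S B \<Gamma>" and j: "j \<in> S"
    and single: "n = 1 \<Longrightarrow> \<exists>!p. monopoly_price M \<pi> Q p"
  shows "expected_revenue M B \<Gamma> j = (1 - \<pi>) ^ (n - 1) * opt"
    and "monopoly_price M \<pi> Q pstar \<Longrightarrow> has_eq_price_law M \<pi> Q n pstar (\<Gamma> j)"
proof -
  define N where "N = \<Gamma> j"
  have br: "best_reply N" unfolding N_def by (rule symmetric_equilibrium_best_reply[OF E j])
  then have rd: "real_distribution N" by (simp add: best_reply_def)
  interpret N: real_distribution N by fact
  have er: "expected_revenue M B \<Gamma> j = (\<integral>p. R p * win_prob N j p \<partial>N)"
    unfolding expected_revenue_def symmetric_equilibrium_revenue[OF E j j] N_def ..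
  have "0 < n" using finite_S S_nonempty by (simp add: card_gt_0_iff)
  then consider "n = 1" | "2 \<le> n" by linarith
  then have "expected_revenue M B \<Gamma> j = (1 - \<pi>) ^ (n - 1) * opt \<and>
    (\<forall>pstar. monopoly_price M \<pi> Q pstar \<longrightarrow> has_eq_price_law M \<pi> Q n pstar N)"
  proof cases
    case 1
    obtain p1 where p1: "monopoly_price M \<pi> Q p1" and p1_unique: "\<And>p. monopoly_price M \<pi> Q p \<Longrightarrow> p = p1"
      using single[OF 1] by blast
    have "msupport N \<subseteq> {p1}"
    proof
      fix q assume q: "q \<in> msupport N"
      have "opt \<le> R q" "0 < q"
        using best_reply_support[OF br q j] 1 by (simp_all add: win_prob_single[OF 1 j])
      then have "monopoly_price M \<pi> Q q"
        using R_le_opt[of q] by (simp add: monopoly_price_iff)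
      then show "q \<in> {p1}" using p1_unique by blast
    qed
    then have N_eq: "N = return borel p1" by (rule return_if_support_singleton[OF rd])
    have "(\<integral>p. R p * win_prob N j p \<partial>N) = R p1"
      unfolding win_prob_single[OF 1 j] N_eq by (simp add: integral_return)
    then have "expected_revenue M B \<Gamma> j = (1 - \<pi>) ^ (n - 1) * opt"
      using er 1 p1 by (simp add: monopoly_price_iff)
    moreover have "has_eq_price_law M \<pi> Q n pstar N" if "monopoly_price M \<pi> Q pstar" for pstar
      unfolding has_eq_price_law_def p1_unique[OF that] using 1 N_eq by simp
    ultimately show ?thesis by blast
  next
    case 2
    have law: "has_eq_price_law M \<pi> Q n pstar N" if "monopoly_price M \<pi> Q pstar" for pstar
      by (rule best_reply_price_law[OF br 2 that])
    obtain pstar where ps: "monopoly_price M \<pi> Q pstar" using ex_monopoly_price by blast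
    note atomless = best_reply_atomless[OF br 2]
    have "cdf N \<in> borel_measurable borel"
      by (intro borel_measurable_mono monoI N.cdf_nondecreasing)
    then have "(\<lambda>p. R p * win_prob N j p) \<in> borel_measurable N"
      unfolding win_prob_atomless[OF rd atomless j] by measurable
    then have "(\<integral>p. R p * win_prob N j p \<partial>N) = (\<integral>p. (1 - \<pi>) ^ (n - 1) * opt \<partial>N)"
      using price_law_revenue(2)[OF rd atomless 2 ps law[OF ps] j] by (intro integral_cong_AE) auto
    also have "\<dots> = (1 - \<pi>) ^ (n - 1) * opt" using N.prob_space by simp
    finally show ?thesis using er law by simp
  qed
  then show "expected_revenue M B \<Gamma> j = (1 - \<pi>) ^ (n - 1) * opt"
    and "monopoly_price M \<pi> Q pstar \<Longrightarrow> has_eq_price_law M \<pi> Q n pstar (\<Gamma> j)"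
    by (auto simp: N_def)
qed

lemma ex_best_reply: "\<exists>N. best_reply N \<and> (AE p in N. 0 \<le> p)"
proof -
  obtain pstar where ps: "monopoly_price M \<pi> Q pstar" using ex_monopoly_price by blast
  have "0 < n" using finite_S S_nonempty by (simp add: card_gt_0_iff)
  then consider "n = 1" | "2 \<le> n" by linarith
  then show ?thesis
  proof cases
    case 1
    have "prob_space (return borel pstar)" by (simp add: prob_space_return)
    moreover have "measure (return borel pstar) {pstar} = 1" by (simp add: measure_return)
    ultimately have "msupport (return borel pstar) \<subseteq> {pstar}"
      by (intro msupport_subset_closed) auto
    then have "best_reply (return borel pstar)"
      using ps R_le_opt \<open>prob_space (return borel pstar)\<close>
      by (auto simp: best_reply_def monopoly_price_iff win_prob_single[OF 1] intro!: real_distributionI)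
    moreover have "AE p in return borel pstar. 0 \<le> p"
      using ps by (subst AE_return) (auto simp: monopoly_price_iff)
    ultimately show ?thesis by blast
  next
    case 2
    obtain N where N: "real_distribution N" "\<And>p. measure N {p} = 0" "has_eq_price_law M \<pi> Q n pstar N"
      using ex_price_law[OF 2 ps] by metis
    note rev = price_law_revenue[OF N(1,2) 2 ps N(3)]
    have "best_reply N" using N(1) rev(1,3) by (simp add: best_reply_def)
    moreover have "AE p in N. 0 \<le> p" using rev(4) S_nonempty by blast
    ultimately show ?thesis by blast
  qed
qed

lemma ex_symmetric_equilibrium: "\<exists>B \<Gamma>. symmetric_equilibrium M S B \<Gamma>"
proof -
  obtain N where br: "best_reply N" and AE: "AE p in N. 0 \<le> p" using ex_best_reply by blast
  interpret N: real_distribution N using br by (simp add: best_reply_def)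
  obtain B where B: "\<And>j. j < nbiz M \<Longrightarrow> prob_space (B j) \<and> sets (B j) = sets borel \<and>
    (AE x in B j. 0 < fst x \<and> fst x < 1 \<and> 0 \<le> snd x \<and> snd x \<le> 1) \<and>
    (if j \<in> S then B j = true_belief M j else lost_belief M (B j) \<and> B j \<noteq> true_belief M j)"
    using ex_equilibrium_beliefs[OF market, of S] by blast
  have N: "prob_space N \<and> sets N = sets borel \<and> (AE p in N. 0 \<le> p)"
    using AE N.prob_space_axioms by simp
  have lost: "lost_belief M (B k) \<and> 0 \<le> qual_mean (B k)" if "k < nbiz M" "k \<notin> S" for k
  proof -
    have "AE x in B k. 0 \<le> snd x" using B[OF that(1)] by auto
    then show ?thesis using B[OF that(1)] that(2) qual_mean_nonneg by auto
  qed
  have learned: "fit_mean (B k) = \<pi> \<and> qual_mean (B k) = Q \<and> N = N" if "k \<in> S" for k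
    using B[of k] that S_subset
    by (auto simp: true_belief_def fit_mean_return qual_mean_return fitp_S qual_S)
  have rev: "revenue M B (\<lambda>_. N) j p' \<le> revenue M B (\<lambda>_. N) j p"
    if j: "j < nbiz M" and p: "p \<in> msupport N" "0 \<le> p'" for j p p'
  proof (cases "j \<in> S")
    case True
    then show ?thesis
      using revenue_eq[of j B "\<lambda>_. N" N, OF True learned lost N] best_replyD[OF br p(1) True p(2)]
      by simp
  next
    case False
    obtain i where "i \<in> S" using S_nonempty by blast
    then have "0 \<le> p" using best_reply_support(2)[OF br p(1), of i] by simp
    then show ?thesis
      using revenue_lost[OF market j, of B] lost[OF j False] p(2) N by simp
  qed
  have "symmetric_equilibrium M S B (\<lambda>_. N)"
    by (rule symmetric_equilibrium_constI[OF S_subset B N rev])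
  then show ?thesis by blast
qed

end

section \<open>Arbitrary learned sets\<close>

lemma symmetric_equilibrium_prices_unique:
  assumes market: "is_market M" and S: "S \<subseteq> {..<nbiz M}"
    and sym: "\<forall>j\<in>S. \<forall>k\<in>S. fitp M j = fitp M k \<and> qual M j = qual M k"
    and pos: "\<forall>j\<in>S. 0 < opt_revenue M (fitp M j) (qual M j)"
    and single: "card S = 1 \<longrightarrow> (\<forall>j\<in>S. \<exists>!p. monopoly_price M (fitp M j) (qual M j) p)"
  shows "\<exists>!\<Gamma>. \<Gamma> \<in> symmetric_equilibrium_prices M S" (is ?unique)
    and "\<lbrakk>symmetric_equilibrium M S B \<Gamma>; j \<in> S\<rbrakk> \<Longrightarrow>
      expected_revenue M B \<Gamma> j =
        (1 - fitp M j) ^ (card S - 1) * opt_revenue M (fitp M j) (qual M j) \<and>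
      (\<exists>pstar. monopoly_price M (fitp M j) (qual M j) pstar) \<and>
      (\<forall>pstar. monopoly_price M (fitp M j) (qual M j) pstar \<longrightarrow>
         has_eq_price_law M (fitp M j) (qual M j) (card S) pstar (\<Gamma> j))"
proof -
  have learned_type: "learned_type M S (fitp M j) (qual M j)" if "j \<in> S" for j
  proof
    show "fitp M k = fitp M j" "qual M k = qual M j" if "k \<in> S" for k
      using sym \<open>j \<in> S\<close> that by (metis, metis)
  qed (use market S pos that in auto)
  have law: "expected_revenue M B \<Gamma> j =
        (1 - fitp M j) ^ (card S - 1) * opt_revenue M (fitp M j) (qual M j) \<and>
      (\<exists>pstar. monopoly_price M (fitp M j) (qual M j) pstar) \<and>
      (\<forall>pstar. monopoly_price M (fitp M j) (qual M j) pstar \<longrightarrow>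
         has_eq_price_law M (fitp M j) (qual M j) (card S) pstar (\<Gamma> j))"
    if E: "symmetric_equilibrium M S B \<Gamma>" and j: "j \<in> S" for B \<Gamma> j
  proof -
    interpret learned_type M S "fitp M j" "qual M j" by (rule learned_type[OF j])
    have "\<exists>!p. monopoly_price M (fitp M j) (qual M j) p" if "card S = 1"
      using single that j by simp
    note revenue_and_law = symmetric_equilibrium_expected_revenue[OF E j this]
    show ?thesis
      by (intro conjI allI impI revenue_and_law ex_monopoly_price)
  qed
  then show "\<lbrakk>symmetric_equilibrium M S B \<Gamma>; j \<in> S\<rbrakk> \<Longrightarrow>
      expected_revenue M B \<Gamma> j =
        (1 - fitp M j) ^ (card S - 1) * opt_revenue M (fitp M j) (qual M j) \<and>
      (\<exists>pstar. monopoly_price M (fitp M j) (qual M j) pstar) \<and>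
      (\<forall>pstar. monopoly_price M (fitp M j) (qual M j) pstar \<longrightarrow>
         has_eq_price_law M (fitp M j) (qual M j) (card S) pstar (\<Gamma> j))" .
  show ?unique
  proof (rule ex_ex1I)
    show "\<exists>\<Gamma>. \<Gamma> \<in> symmetric_equilibrium_prices M S"
    \<comment> \<open>Without a learned business there is no type to work with, and all restrictions
      to \<open>{}\<close> coincide, so only existence matters. Price 0 for everyone will do, as all
      businesses are lost.\<close>
    proof (cases "S = {}")
      case True
      obtain B where B: "\<And>j. j < nbiz M \<Longrightarrow> prob_space (B j) \<and> sets (B j) = sets borel \<and>
        (AE x in B j. 0 < fst x \<and> fst x < 1 \<and> 0 \<le> snd x \<and> snd x \<le> 1) \<and>
        (if j \<in> S then B j = true_belief M j else lost_belief M (B j) \<and> B j \<noteq> true_belief M j)"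
        using ex_equilibrium_beliefs[OF market, of S] by blast
      define N where "N = (return borel 0 :: real measure)"
      have "AE p in N. 0 \<le> p" unfolding N_def by (subst AE_return) auto
      then have N: "prob_space N \<and> sets N = sets borel \<and> (AE p in N. 0 \<le> p)"
        by (simp add: N_def prob_space_return)
      then have "msupport N \<subseteq> {0}"
        by (intro msupport_subset_closed) (auto simp: N_def measure_return)
      have rev: "revenue M B (\<lambda>_. N) j p = 0" if "j < nbiz M" "0 \<le> p" for j p
      proof -
        have "AE x in B j. 0 \<le> snd x" "lost_belief M (B j)"
          using B[OF that(1)] True by auto
        then show ?thesis
          using N that by (intro revenue_lost market qual_mean_nonneg) simp_all
      qed
      have "symmetric_equilibrium M S B (\<lambda>_. N)"
      proof (rule symmetric_equilibrium_constI[OF S B N])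
        fix j p and p' :: real assume "j < nbiz M" "p \<in> msupport N" "0 \<le> p'"
        moreover from this have "p = 0" using \<open>msupport N \<subseteq> {0}\<close> by blast
        ultimately show "revenue M B (\<lambda>_. N) j p' \<le> revenue M B (\<lambda>_. N) j p"
          by (simp add: rev)
      qed
      then show ?thesis by (auto simp: symmetric_equilibrium_prices_def)
    next
      case False
      then obtain j where "j \<in> S" by blast
      then obtain B \<Gamma> where "symmetric_equilibrium M S B \<Gamma>"
        using learned_type.ex_symmetric_equilibrium[OF learned_type] by metis
      then show ?thesis
        unfolding symmetric_equilibrium_prices_def by blast
    qed
  next
    fix \<Gamma> \<Gamma>' assume "\<Gamma> \<in> symmetric_equilibrium_prices M S" "\<Gamma>' \<in> symmetric_equilibrium_prices M S"
    then obtain B \<Gamma>0 B' \<Gamma>0' where E: "symmetric_equilibrium M S B \<Gamma>0" "\<Gamma> = restrict \<Gamma>0 S"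
      and E': "symmetric_equilibrium M S B' \<Gamma>0'" "\<Gamma>' = restrict \<Gamma>0' S"
      by (auto simp: symmetric_equilibrium_prices_def)
    have "\<Gamma>0 j = \<Gamma>0' j" if j: "j \<in> S" for j
    proof -
      interpret learned_type M S "fitp M j" "qual M j" by (rule learned_type[OF j])
      obtain pstar where ps: "monopoly_price M (fitp M j) (qual M j) pstar"
        using ex_monopoly_price by blast
      have "real_distribution (\<Gamma>0 j)" "real_distribution (\<Gamma>0' j)"
        using symmetric_equilibrium_best_reply[OF E(1) j]
          symmetric_equilibrium_best_reply[OF E'(1) j] by (simp_all add: best_reply_def)
      moreover have "has_eq_price_law M (fitp M j) (qual M j) (card S) pstar (\<Gamma>0 j)"
        "has_eq_price_law M (fitp M j) (qual M j) (card S) pstar (\<Gamma>0' j)"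
        using law[OF E(1) j] law[OF E'(1) j] ps by simp_all
      ultimately show ?thesis by (rule has_eq_price_law_unique)
    qed
    then show "\<Gamma> = \<Gamma>'" using E(2) E'(2) by (auto simp: restrict_def)
  qed
qed

text \<open>Learned-symmetry supplies the event of full measure. On it the realized learned set is
  just a set of businesses of equal type, and the claim holds for every such set.\<close>

theorem theorem7p12:
  fixes M :: market
  assumes "is_market M" and "learned_symmetric M"
  shows "AE \<omega> in market_space M.
    let S = learned_set M \<omega>; n = card S in
      (\<forall>j\<in>S. 0 < opt_revenue M (fitp M j) (qual M j)) \<longrightarrow>
      (n = 1 \<longrightarrow> (\<forall>j\<in>S. \<exists>!p. monopoly_price M (fitp M j) (qual M j) p)) \<longrightarrow>
      (\<exists>!\<Gamma>. \<Gamma> \<in> symmetric_equilibrium_prices M S) \<and>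
      (\<forall>B \<Gamma>. symmetric_equilibrium M S B \<Gamma> \<longrightarrow>
         (\<forall>j\<in>S. let \<pi> = fitp M j; Q = qual M j in
            expected_revenue M B \<Gamma> j = (1 - \<pi>) ^ (n - 1) * opt_revenue M \<pi> Q \<and>
            (\<exists>pstar. monopoly_price M \<pi> Q pstar) \<and>
            (\<forall>pstar. monopoly_price M \<pi> Q pstar \<longrightarrow>
               has_eq_price_law M \<pi> Q n pstar (\<Gamma> j))))"
  using assms(2) unfolding learned_symmetric_def
proof eventually_elim
  case (elim \<omega>)
  have "learned_set M \<omega> \<subseteq> {..<nbiz M}" by (auto simp: learned_set_def)
  note unique = symmetric_equilibrium_prices_unique[OF assms(1) this elim]
  show ?case
    unfolding Let_def using unique by (intro impI conjI allI ballI) blast+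
qed

end
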